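(* Let $\Pi_f\subseteq Gr(k,n)$ be a positroid variety and let $\lambda\in\binom{[n]}{k}$ be a $T$-fixed point lying on $\Pi_f$. If $\Pi_f$ is smooth at $\lambda$, then for every $i\in[n]\setminus\lambda$ the deletion $\Pi_f\cap\Pi_{del,i}$ is smooth at $\lambda$, and for every $i\in\lambda$ the contraction $\Pi_f\cap\Pi_{contr,i}$ is smooth at $\lambda$. Contrapositively: if $\lambda$ is singular on the deletion (for $i\notin\lambda$) or on the contraction (for $i\in\lambda$) of the $i$-th column of $\Pi_f$, then $\lambda$ is singular on $\Pi_f$.
   Context: $Gr(k,n)$ is the Grassmannian of $k$-planes in $\mathbb{C}^n$, a point being the row span of a full-rank complex $k\times n$ matrix $M$. The $T$-fixed point $\lambda\in\binom{[n]}{k}$ ($T$ the diagonal torus acting by right multiplication) is the coordinate plane spanned by $e_i$, $i\in\lambda$. A bounded affine permutation for $(k,n)$ is a bijection $f:\mathbb{Z}\to\mathbb{Z}$ with $f(i+n)=f(i)+n$, $i\le f(i)\le i+n$, and $\frac1n\sum_{i=1}^n (f(i)-i)=k$. Extending the columns of $M$ periodically modulo $n$, the positroid variety $\Pi_f$ is the set of row spans of those $M$ such that for all $i\le j\le i+n$ the rank of columns $i,\dots,j$ is at most $(j-i+1)-\#\{a\ge i: f(a)\le j\}$. $\Pi_{del,i}=\{V\in Gr(k,n): V\subseteq\{x_i=0\}\}\cong Gr(k,n-1)$ and $\Pi_{contr,i}=\{V\in Gr(k,n): e_i\in V\}\cong Gr(k-1,n-1)$. The deletion (resp. contraction) of the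 $i$-th column of $\Pi_f$ is the intersection $\Pi_f\cap\Pi_{del,i}$ (resp. $\Pi_f\cap\Pi_{contr,i}$), regarded via these isomorphisms as a subvariety of the smaller Grassmannian; the point $\lambda$ lies in $\Pi_{del,i}$ exactly when $i\notin\lambda$ and in $\Pi_{contr,i}$ exactly when $i\in\lambda$. When nonempty the deletion and contraction are again positroid varieties. *)

theory Defs
  imports Complex_Main "HOL-Library.Function_Algebras" "HOL-Library.Extended_Nat"
begin

section \<open>Complex coordinate spaces\<close>

interpretation cvec: vector_space "\<lambda>(c::complex) (v :: 'a \<Rightarrow> complex) j. c * v j"
  by unfold_locales (auto simp: fun_eq_iff algebra_simps)

text \<open>
  The space \<open>\<complex>\<^sup>J\<close> for a finite index set \<open>J\<close>, as the functions that vanish outside \<open>J\<close>.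
\<close>
definition cspace :: "'a set \<Rightarrow> ('a \<Rightarrow> complex) set" where
  "cspace J = {v. \<forall>j. j \<notin> J \<longrightarrow> v j = 0}"

definition unit_vec :: "'a \<Rightarrow> 'a \<Rightarrow> complex" where
  "unit_vec i = (\<lambda>j. if j = i then 1 else 0)"

section \<open>Affine algebraic sets and their smooth points\<close>

text \<open>
  The coordinate ring of the affine space \<open>\<complex>\<^sup>J\<close>. As \<open>\<complex>\<close> is infinite, a polynomial is
  determined by the function that it induces, so polynomial functions stand for polynomials.
\<close>
inductive_set polyfun :: "'a set \<Rightarrow> (('a \<Rightarrow> complex) \<Rightarrow> complex) set" for J :: "'a set" where
  const: "(\<lambda>x. c) \<in> polyfun J"
| coord: "j \<in> J \<Longrightarrow> (\<lambda>x. x j) \<in> polyfun J"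
| add: "g \<in> polyfun J \<Longrightarrow> h \<in> polyfun J \<Longrightarrow> (\<lambda>x. g x + h x) \<in> polyfun J"
| mult: "g \<in> polyfun J \<Longrightarrow> h \<in> polyfun J \<Longrightarrow> (\<lambda>x. g x * h x) \<in> polyfun J"

definition vanishing_ideal ::
    "'a set \<Rightarrow> ('a \<Rightarrow> complex) set \<Rightarrow> (('a \<Rightarrow> complex) \<Rightarrow> complex) set" where
  "vanishing_ideal J X = {g \<in> polyfun J. \<forall>x\<in>X. g x = 0}"

definition zariski_closed :: "'a set \<Rightarrow> ('a \<Rightarrow> complex) set \<Rightarrow> bool" where
  "zariski_closed J Z \<longleftrightarrow> (\<exists>S \<subseteq> polyfun J. Z = {x \<in> cspace J. \<forall>g\<in>S. g x = 0})"

definition irreducible_closed :: "'a set \<Rightarrow> ('a \<Rightarrow> complex) set \<Rightarrow> bool" where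
  "irreducible_closed J Z \<longleftrightarrow> zariski_closed J Z \<and> Z \<noteq> {} \<and>
     (\<forall>A B. zariski_closed J A \<longrightarrow> zariski_closed J B \<longrightarrow> Z = A \<union> B \<longrightarrow> Z = A \<or> Z = B)"

text \<open>
  The dimension of \<open>X\<close> at \<open>p\<close>, i.e. the Krull dimension of the local ring of \<open>X\<close> at \<open>p\<close>: prime
  ideals of this ring correspond to the irreducible closed subsets of \<open>X\<close> that contain \<open>p\<close>.
\<close>
definition local_dim :: "'a set \<Rightarrow> ('a \<Rightarrow> complex) set \<Rightarrow> ('a \<Rightarrow> complex) \<Rightarrow> enat" where
  "local_dim J X p = Sup {enat d | d. \<exists>Z :: nat \<Rightarrow> ('a \<Rightarrow> complex) set.
     (\<forall>i\<le>d. irreducible_closed J (Z i) \<and> p \<in> Z i \<and> Z i \<subseteq> X) \<and> (\<forall>i<d. Z i \<subset> Z (Suc i))}"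

text \<open>
  The Zariski tangent space of \<open>X\<close> (with its reduced structure) at \<open>p\<close>: the vectors along which
  the directional derivative at \<open>p\<close> of every polynomial vanishing on \<open>X\<close> is zero.
\<close>
definition tangent_space ::
    "'a set \<Rightarrow> ('a \<Rightarrow> complex) set \<Rightarrow> ('a \<Rightarrow> complex) \<Rightarrow> ('a \<Rightarrow> complex) set" where
  "tangent_space J X p = {v \<in> cspace J. \<forall>g \<in> vanishing_ideal J X.
     ((\<lambda>t. g (\<lambda>j. p j + t * v j)) has_field_derivative 0) (at 0)}"

definition affine_smooth_at :: "'a set \<Rightarrow> ('a \<Rightarrow> complex) set \<Rightarrow> ('a \<Rightarrow> complex) \<Rightarrow> bool" where
  "affine_smooth_at J X p \<longleftrightarrow>
     p \<in> X \<and> local_dim J X p = enat (cvec.dim (tangent_space J X p))"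

section \<open>The Grassmannian\<close>

definition grassmannian :: "nat \<Rightarrow> nat \<Rightarrow> (int \<Rightarrow> complex) set set" where
  "grassmannian k n = {V. cvec.subspace V \<and> V \<subseteq> cspace {1..int n} \<and> cvec.dim V = k}"

definition coord_plane :: "int set \<Rightarrow> (int \<Rightarrow> complex) set" where
  "coord_plane lam = cvec.span (unit_vec ` lam)"

text \<open>
  The standard affine chart \<open>\<complex>\<^bsup>\<mu> \<times> ([n] - \<mu>)\<^esup>\<close> of the Grassmannian at the coordinate plane
  of \<open>\<mu>\<close>: the point with coordinates \<open>A\<close> is the row span of the matrix whose rows are indexed by
  \<open>\<mu>\<close>, whose columns in \<open>\<mu>\<close> form the identity matrix, and whose other columns are those of \<open>A\<close>.
\<close>
definition chart_coords :: "nat \<Rightarrow> int set \<Rightarrow> (int \<times> int) set" where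
  "chart_coords n mu = mu \<times> ({1..int n} - mu)"

definition chart_point :: "int set \<Rightarrow> (int \<times> int \<Rightarrow> complex) \<Rightarrow> (int \<Rightarrow> complex) set" where
  "chart_point mu A =
     cvec.span ((\<lambda>r c. if c \<in> mu then (if c = r then 1 else 0) else A (r, c)) ` mu)"

text \<open>
  Smoothness is local, so it may be tested in a chart around the point; the choice of the chart
  does not matter because the transition maps are isomorphisms of varieties.
\<close>
definition smooth_at ::
    "nat \<Rightarrow> nat \<Rightarrow> (int \<Rightarrow> complex) set set \<Rightarrow> (int \<Rightarrow> complex) set \<Rightarrow> bool" where
  "smooth_at k n X V \<longleftrightarrow> (\<exists>mu A. mu \<subseteq> {1..int n} \<and> card mu = k \<and>
     A \<in> cspace (chart_coords n mu) \<and> chart_point mu A = V \<and>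
     affine_smooth_at (chart_coords n mu)
       {B \<in> cspace (chart_coords n mu). chart_point mu B \<in> X} A)"

definition singular_at ::
    "nat \<Rightarrow> nat \<Rightarrow> (int \<Rightarrow> complex) set set \<Rightarrow> (int \<Rightarrow> complex) set \<Rightarrow> bool" where
  "singular_at k n X V \<longleftrightarrow> V \<in> X \<and> \<not> smooth_at k n X V"

section \<open>Positroid varieties\<close>

definition bounded_affine_perm :: "nat \<Rightarrow> nat \<Rightarrow> (int \<Rightarrow> int) \<Rightarrow> bool" where
  "bounded_affine_perm k n f \<longleftrightarrow> n \<ge> 1 \<and> bij f \<and>
     (\<forall>i. f (i + int n) = f i + int n) \<and>
     (\<forall>i. i \<le> f i \<and> f i \<le> i + int n) \<and>
     (\<Sum>i = 1..int n. real_of_int (f i - i)) / real n = real k"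

text \<open>
  A \<open>k \<times> n\<close> matrix is a function of a row in \<open>{1..k}\<close> and a column in \<open>{1..n}\<close>, zero elsewhere.
\<close>
definition is_matrix :: "nat \<Rightarrow> nat \<Rightarrow> (nat \<Rightarrow> int \<Rightarrow> complex) \<Rightarrow> bool" where
  "is_matrix k n M \<longleftrightarrow> (\<forall>r c. r \<notin> {1..k} \<or> c \<notin> {1..int n} \<longrightarrow> M r c = 0)"

definition row_span :: "nat \<Rightarrow> (nat \<Rightarrow> int \<Rightarrow> complex) \<Rightarrow> (int \<Rightarrow> complex) set" where
  "row_span k M = cvec.span (M ` {1..k})"

definition full_rank_matrix :: "nat \<Rightarrow> nat \<Rightarrow> (nat \<Rightarrow> int \<Rightarrow> complex) \<Rightarrow> bool" where
  "full_rank_matrix k n M \<longleftrightarrow> is_matrix k n M \<and> cvec.dim (row_span k M) = k"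

definition periodic_column :: "nat \<Rightarrow> (nat \<Rightarrow> int \<Rightarrow> complex) \<Rightarrow> int \<Rightarrow> nat \<Rightarrow> complex" where
  "periodic_column n M c = (\<lambda>r. M r ((c - 1) mod int n + 1))"

definition column_rank :: "nat \<Rightarrow> (nat \<Rightarrow> int \<Rightarrow> complex) \<Rightarrow> int \<Rightarrow> int \<Rightarrow> nat" where
  "column_rank n M i j = cvec.dim (cvec.span (periodic_column n M ` {i..j}))"

definition positroid_variety ::
    "nat \<Rightarrow> nat \<Rightarrow> (int \<Rightarrow> int) \<Rightarrow> (int \<Rightarrow> complex) set set" where
  "positroid_variety k n f = {row_span k M | M. full_rank_matrix k n M \<and>
     (\<forall>i j. i \<le> j \<and> j \<le> i + int n \<longrightarrow>
        int (column_rank n M i j) \<le> (j - i + 1) - int (card {a. a \<ge> i \<and> f a \<le> j}))}"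

section \<open>Deletion and contraction\<close>

definition del_locus :: "nat \<Rightarrow> nat \<Rightarrow> int \<Rightarrow> (int \<Rightarrow> complex) set set" where
  "del_locus k n i = {V \<in> grassmannian k n. V \<subseteq> {x. x i = 0}}"

definition contr_locus :: "nat \<Rightarrow> nat \<Rightarrow> int \<Rightarrow> (int \<Rightarrow> complex) set set" where
  "contr_locus k n i = {V \<in> grassmannian k n. unit_vec i \<in> V}"

text \<open>
  Dropping the \<open>i\<close>-th coordinate and renumbering the later ones identifies \<open>{x. x i = 0}\<close>,
  and also the quotient of \<open>\<complex>\<^sup>n\<close> by the line spanned by \<open>unit_vec i\<close>, with \<open>\<complex>\<^bsup>n-1\<^esup>\<close>. On subspaces, \<open>drop_plane i\<close>
  is therefore the isomorphism of \<open>del_locus k n i\<close> with \<open>grassmannian k (n - 1)\<close> as well as that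
  of \<open>contr_locus k n i\<close> with \<open>grassmannian (k - 1) (n - 1)\<close>.
\<close>
definition drop_coord :: "int \<Rightarrow> (int \<Rightarrow> complex) \<Rightarrow> int \<Rightarrow> complex" where
  "drop_coord i v = (\<lambda>j. if j < i then v j else v (j + 1))"

definition drop_plane :: "int \<Rightarrow> (int \<Rightarrow> complex) set \<Rightarrow> (int \<Rightarrow> complex) set" where
  "drop_plane i V = drop_coord i ` V"

definition deletion :: "nat \<Rightarrow> nat \<Rightarrow> (int \<Rightarrow> int) \<Rightarrow> int \<Rightarrow> (int \<Rightarrow> complex) set set" where
  "deletion k n f i = drop_plane i ` (positroid_variety k n f \<inter> del_locus k n i)"

definition contraction :: "nat \<Rightarrow> nat \<Rightarrow> (int \<Rightarrow> int) \<Rightarrow> int \<Rightarrow> (int \<Rightarrow> complex) set set" where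
  "contraction k n f i = drop_plane i ` (positroid_variety k n f \<inter> contr_locus k n i)"

end

theory Submission
  imports Defs "HOL-Library.FuncSet" "HOL-Computational_Algebra.Polynomial"
begin

text \<open>
  The torus acts on the chart of the Grassmannian at the coordinate plane of \<open>\<lambda>\<close> by scaling rows and
  columns. In particular, the element that is \<open>1\<close> on \<open>\<lambda>\<close> and \<open>t\<close> off \<open>\<lambda>\<close> multiplies every chart
  coordinate by \<open>t\<close>. The rank conditions that define a positroid variety are invariant under the torus,
  so in this chart the variety is a cone \<open>X\<close> whose vertex, the origin, is the fixed point \<open>\<lambda>\<close>
  (\<open>chart_point_scaling\<close>, \<open>positroid_variety_scaling\<close>).

  A cone that is smooth at its vertex is a linear subspace (\<open>smooth_cone_subspace\<close>): it is contained in
  its tangent space at the vertex, which is irreducible, and it has the same dimension there.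
  In the chart, deletion and contraction set one column or one row of the coordinate matrix to zero
  (\<open>chart_part_minor\<close>). So if \<open>X\<close> is linear, both are again linear subspaces, and a linear subspace is
  smooth at the origin (\<open>affine_smooth_at_subspace\<close>). The coordinate plane of \<open>\<lambda>\<close> lies in just one
  chart, with coordinates \<open>0\<close> (\<open>chart_point_eq_coord_plane\<close>), so smoothness at this point, which
  is defined through some chart, is smoothness at the origin of that chart.

  What remains is dimension theory: the Krull dimension of a linear subspace \<open>L\<close> at the origin
  is \<open>dim L\<close> (\<open>local_dim_subspace\<close>). Flags of linear subspaces give one inequality. For the other one, a
  chain of irreducible closed sets of length \<open>m\<close> yields \<open>m\<close> algebraically independent polynomials
  (\<open>chain_monomials_independent\<close>), and counting monomials shows that there are at most as many of
  these as there are coordinates (\<open>irreducible_chain_length_le\<close>).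
\<close>

section \<open>Polynomial functions\<close>

lemma polyfun_sum:
  assumes "finite I" "\<And>i. i \<in> I \<Longrightarrow> h i \<in> polyfun J"
  shows "(\<lambda>x. \<Sum>i\<in>I. h i x) \<in> polyfun J"
  using assms by (induction I) (auto intro: polyfun.intros)

lemma polyfun_power: "g \<in> polyfun J \<Longrightarrow> (\<lambda>x. g x ^ r) \<in> polyfun J"
  by (induction r) (auto intro: polyfun.intros)

lemma polyfun_on_line:
  assumes "g \<in> polyfun J"
  shows "\<exists>q. \<forall>t. g (\<lambda>j. p j + t * v j) = poly q t"
  using assms
proof induction
  case (const c)
  show ?case by (rule exI[of _ "[:c:]"]) simp
next
  case (coord j)
  show ?case by (rule exI[of _ "[:p j, v j:]"]) simp
next
  case (add g h)
  then obtain q r where "\<forall>t. g (\<lambda>j. p j + t * v j) = poly q t" "\<forall>t. h (\<lambda>j. p j + t * v j) = poly r t"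
    by blast
  then show ?case by (intro exI[of _ "q + r"]) simp
next
  case (mult g h)
  then obtain q r where "\<forall>t. g (\<lambda>j. p j + t * v j) = poly q t" "\<forall>t. h (\<lambda>j. p j + t * v j) = poly r t"
    by blast
  then show ?case by (intro exI[of _ "q * r"]) simp
qed

text \<open>
  The formal differential of \<open>g\<close> at \<open>p\<close>; its linearity is what makes the tangent space a linear subspace.
\<close>
lemma polyfun_directional_derivative:
  assumes "g \<in> polyfun J"
  shows "\<exists>D. (\<forall>u v. D (\<lambda>j. u j + v j) = D u + D v) \<and> (\<forall>c v. D (\<lambda>j. c * v j) = c * D v) \<and>
    (\<forall>v. ((\<lambda>t. g (\<lambda>j. p j + t * v j)) has_field_derivative D v) (at 0))"
  using assms
proof induction
  case (const c)
  show ?case by (rule exI[of _ "\<lambda>_. 0"]) simp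
next
  case (coord j)
  show ?case
    by (rule exI[of _ "\<lambda>v. v j"]) (auto intro!: derivative_eq_intros)
next
  case (add g h)
  then obtain D E where
      "\<forall>u v. D (\<lambda>j. u j + v j) = D u + D v" "\<forall>c v. D (\<lambda>j. c * v j) = c * D v"
      "\<forall>v. ((\<lambda>t. g (\<lambda>j. p j + t * v j)) has_field_derivative D v) (at 0)"
      "\<forall>u v. E (\<lambda>j. u j + v j) = E u + E v" "\<forall>c v. E (\<lambda>j. c * v j) = c * E v"
      "\<forall>v. ((\<lambda>t. h (\<lambda>j. p j + t * v j)) has_field_derivative E v) (at 0)"
    by blast
  then show ?case
    by (intro exI[of _ "\<lambda>v. D v + E v"]) (auto intro!: DERIV_add simp: algebra_simps)
next
  case (mult g h)
  then obtain D E where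
      "\<forall>u v. D (\<lambda>j. u j + v j) = D u + D v" "\<forall>c v. D (\<lambda>j. c * v j) = c * D v"
      and D: "\<forall>v. ((\<lambda>t. g (\<lambda>j. p j + t * v j)) has_field_derivative D v) (at 0)"
      and "\<forall>u v. E (\<lambda>j. u j + v j) = E u + E v" "\<forall>c v. E (\<lambda>j. c * v j) = c * E v"
      and E: "\<forall>v. ((\<lambda>t. h (\<lambda>j. p j + t * v j)) has_field_derivative E v) (at 0)"
    by blast
  moreover have "((\<lambda>t. g (\<lambda>j. p j + t * v j) * h (\<lambda>j. p j + t * v j)) has_field_derivative
      D v * h p + E v * g p) (at 0)" for v
    using DERIV_mult[OF D[rule_format, of v] E[rule_format, of v]] by simp
  ultimately show ?case
    by (intro exI[of _ "\<lambda>v. D v * h p + E v * g p"]) (auto simp: algebra_simps)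
qed

lemma subspace_cspace: "cvec.subspace (cspace J)"
  by (auto simp: cvec.subspace_def cspace_def)

lemma subspace_tangent_space: "cvec.subspace (tangent_space J X p)"
proof -
  have 1: "u + v \<in> tangent_space J X p"
    if "u \<in> tangent_space J X p" "v \<in> tangent_space J X p" for u v
  proof -
    have "((\<lambda>t. g (\<lambda>j. p j + t * (u j + v j))) has_field_derivative 0) (at 0)"
      if g: "g \<in> vanishing_ideal J X" for g
    proof -
      have "g \<in> polyfun J" using g by (simp add: vanishing_ideal_def)
      from polyfun_directional_derivative[OF this, of p] obtain D where
        D: "D (\<lambda>j. u j + v j) = D u + D v" "\<forall>v. ((\<lambda>t. g (\<lambda>j. p j + t * v j)) has_field_derivative D v) (at 0)"
        by blast
      have "D u = 0" "D v = 0"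
        using D(2) g \<open>u \<in> _\<close> \<open>v \<in> _\<close> DERIV_unique unfolding tangent_space_def by blast+
      then show ?thesis using D by (metis add_0)
    qed
    then show ?thesis using that cvec.subspace_add[OF subspace_cspace]
      by (auto simp: tangent_space_def)
  qed
  have 2: "(\<lambda>j. c * v j) \<in> tangent_space J X p"
    if "v \<in> tangent_space J X p" for c v
  proof -
    have "((\<lambda>t. g (\<lambda>j. p j + t * (c * v j))) has_field_derivative 0) (at 0)"
      if g: "g \<in> vanishing_ideal J X" for g
    proof -
      have "g \<in> polyfun J" using g by (simp add: vanishing_ideal_def)
      from polyfun_directional_derivative[OF this, of p] obtain D where
        D: "D (\<lambda>j. c * v j) = c * D v" "\<forall>v. ((\<lambda>t. g (\<lambda>j. p j + t * v j)) has_field_derivative D v) (at 0)"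
        by blast
      have "D v = 0"
        using D(2) g \<open>v \<in> _\<close> DERIV_unique unfolding tangent_space_def by blast
      then show ?thesis using D by (metis mult_zero_right)
    qed
    then show ?thesis using that
      by (auto simp: tangent_space_def cspace_def)
  qed
  have 3: "0 \<in> tangent_space J X p"
    by (auto simp: tangent_space_def cspace_def)
  show ?thesis using 1 2 3 by (auto simp: cvec.subspace_def)
qed

section \<open>Independent monomials from a chain of irreducible closed sets\<close>

lemma zariski_closed_zero_locus:
  assumes "zariski_closed J W" "g \<in> polyfun J"
  shows "zariski_closed J {x \<in> W. g x = 0}"
proof -
  obtain S where "S \<subseteq> polyfun J" "W = {x \<in> cspace J. \<forall>g\<in>S. g x = 0}"
    using assms(1) by (auto simp: zariski_closed_def)
  then show ?thesis using assms(2) unfolding zariski_closed_def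
    by (intro exI[of _ "insert g S"]) auto
qed

lemma zariski_closed_separation:
  assumes "zariski_closed J A" "x \<in> cspace J" "x \<notin> A"
  obtains g where "g \<in> polyfun J" "\<And>y. y \<in> A \<Longrightarrow> g y = 0" "g x \<noteq> 0"
proof -
  obtain S where "S \<subseteq> polyfun J" "A = {x \<in> cspace J. \<forall>g\<in>S. g x = 0}"
    using assms(1) by (auto simp: zariski_closed_def)
  then show ?thesis using assms(2,3) that by blast
qed

lemma irreducible_closed_subset_cspace: "irreducible_closed J Z \<Longrightarrow> Z \<subseteq> cspace J"
  by (auto simp: irreducible_closed_def zariski_closed_def)

lemma irreducible_closed_mult_eq_0:
  assumes W: "irreducible_closed J W" and g: "g \<in> polyfun J" and h: "h \<in> polyfun J"
    and gh: "\<And>x. x \<in> W \<Longrightarrow> g x * h x = 0"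
  shows "(\<forall>x\<in>W. g x = 0) \<or> (\<forall>x\<in>W. h x = 0)"
proof -
  have "zariski_closed J {x \<in> W. g x = 0}" "zariski_closed J {x \<in> W. h x = 0}"
    using W g h zariski_closed_zero_locus by (auto simp: irreducible_closed_def)
  moreover have "W = {x \<in> W. g x = 0} \<union> {x \<in> W. h x = 0}" using gh by auto
  ultimately have "W = {x \<in> W. g x = 0} \<or> W = {x \<in> W. h x = 0}"
    using W unfolding irreducible_closed_def by blast
  then show ?thesis by blast
qed

text \<open>
  A relation \<open>\<Sum>\<^sub>r g\<^sup>r h\<^sub>r = 0\<close> on \<open>W\<close> with \<open>h\<^sub>r\<close> in the linear span of the family \<open>h\<close> restricts on
  \<open>Z\<close>, where \<open>g\<close> vanishes, to \<open>h\<^sub>0 = 0\<close>, so \<open>h\<^sub>0\<close> is the trivial combination. What is left is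
  divisible by \<open>g\<close>, and \<open>g\<close> can be cancelled because \<open>W\<close> is irreducible; this lowers the number of
  terms. Each step up in a chain of irreducible closed sets thus yields one more algebraically
  independent function.
\<close>
lemma powers_times_independent:
  assumes W: "irreducible_closed J W" and ZW: "Z \<subseteq> W"
    and g: "g \<in> polyfun J" and gZ: "\<And>x. x \<in> Z \<Longrightarrow> g x = 0" and gW: "\<exists>x\<in>W. g x \<noteq> 0"
    and I: "finite I" and h: "\<And>a. a \<in> I \<Longrightarrow> h a \<in> polyfun J"
    and ind: "\<And>c. (\<And>x. x \<in> Z \<Longrightarrow> (\<Sum>a\<in>I. c a * h a x) = 0) \<Longrightarrow> \<forall>a\<in>I. c a = 0"
    and "\<And>x. x \<in> W \<Longrightarrow> (\<Sum>r<s. g x ^ r * (\<Sum>a\<in>I. c r a * h a x)) = 0"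
  shows "\<forall>r<s. \<forall>a\<in>I. c r a = 0"
  using assms(9)
proof (induction s arbitrary: c)
  case 0
  then show ?case by simp
next
  case (Suc s)
  let ?rest = "\<lambda>x. \<Sum>r<s. g x ^ r * (\<Sum>a\<in>I. c (Suc r) a * h a x)"
  have split: "(\<Sum>r<Suc s. g x ^ r * (\<Sum>a\<in>I. c r a * h a x))
      = (\<Sum>a\<in>I. c 0 a * h a x) + g x * ?rest x" for x
    by (subst sum.lessThan_Suc_shift) (simp add: sum_distrib_left mult.assoc)
  have c0: "\<forall>a\<in>I. c 0 a = 0"
  proof (rule ind)
    fix x assume "x \<in> Z"
    then show "(\<Sum>a\<in>I. c 0 a * h a x) = 0"
      using Suc.prems[of x] split[of x] gZ[of x] ZW by auto
  qed
  have prod: "g x * ?rest x = 0" if "x \<in> W" for x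
    using Suc.prems[OF that] split[of x] c0 by simp
  have "?rest \<in> polyfun J"
    by (intro polyfun_sum polyfun.mult polyfun_power polyfun.const I g h) auto
  from irreducible_closed_mult_eq_0[OF W g this prod] gW
  have "\<forall>x\<in>W. ?rest x = 0" by blast
  then have "\<forall>r<s. \<forall>a\<in>I. c (Suc r) a = 0"
    by (intro Suc.IH) auto
  then show ?case using c0 less_Suc_eq_0_disj by auto
qed

text \<open>
  Exponent vectors are lists, the exponent of the last function being the head. In this way a step
  from \<open>m\<close> to \<open>m + 1\<close> functions is a \<open>Cons\<close>, and vectors of all lengths share one type.
\<close>
fun list_monomial :: "(nat \<Rightarrow> 'x \<Rightarrow> complex) \<Rightarrow> nat list \<Rightarrow> 'x \<Rightarrow> complex" where
  "list_monomial g [] x = 1"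
| "list_monomial g (r # rs) x = g (length rs) x ^ r * list_monomial g rs x"

definition exponents :: "nat \<Rightarrow> nat \<Rightarrow> nat list set" where
  "exponents s m = {rs. set rs \<subseteq> {..<s} \<and> length rs = m}"

lemma exponents_0: "exponents s 0 = {[]}"
  by (auto simp: exponents_def)

lemma exponents_Suc: "exponents s (Suc m) = (\<lambda>(r, rs). r # rs) ` ({..<s} \<times> exponents s m)"
  by (auto simp: exponents_def length_Suc_conv)

lemma finite_exponents: "finite (exponents s m)"
  by (simp add: exponents_def finite_lists_length_eq)

lemma card_exponents: "card (exponents s m) = s ^ m"
  by (simp add: exponents_def card_lists_length_eq)

lemma polyfun_list_monomial:
  "(\<And>i. i < length rs \<Longrightarrow> g i \<in> polyfun J) \<Longrightarrow> list_monomial g rs \<in> polyfun J"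
proof (induction rs)
  case Nil
  have "list_monomial g [] = (\<lambda>x. 1)" by auto
  then show ?case using polyfun.const by simp
next
  case (Cons r rs)
  have "list_monomial g (r # rs) = (\<lambda>x. g (length rs) x ^ r * list_monomial g rs x)" by auto
  then show ?case using Cons by (auto intro!: polyfun.mult polyfun_power)
qed

lemma chain_monomials_independent:
  assumes "\<And>i. i \<le> m \<Longrightarrow> irreducible_closed J (Z i)" "\<And>i. i < m \<Longrightarrow> Z i \<subseteq> Z (Suc i)"
    and "\<And>i. i < m \<Longrightarrow> g i \<in> polyfun J" "\<And>i x. i < m \<Longrightarrow> x \<in> Z i \<Longrightarrow> g i x = 0"
    and "\<And>i. i < m \<Longrightarrow> \<exists>x\<in>Z (Suc i). g i x \<noteq> 0"
    and "\<And>x. x \<in> Z m \<Longrightarrow> (\<Sum>rs\<in>exponents s m. c rs * list_monomial g rs x) = 0"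
  shows "\<forall>rs\<in>exponents s m. c rs = 0"
  using assms
proof (induction m arbitrary: c)
  case 0
  from "0.prems"(1)[of 0] obtain x where "x \<in> Z 0" by (auto simp: irreducible_closed_def)
  from "0.prems"(6)[OF this] show ?case by (simp add: exponents_0)
next
  case (Suc m)
  have "\<forall>r<s. \<forall>rs\<in>exponents s m. c (r # rs) = 0"
  proof (rule powers_times_independent[where g = "g m" and Z = "Z m" and h = "list_monomial g"])
    show "irreducible_closed J (Z (Suc m))" "Z m \<subseteq> Z (Suc m)" "g m \<in> polyfun J"
      "\<exists>x\<in>Z (Suc m). g m x \<noteq> 0" using Suc.prems by auto
    show "g m x = 0" if "x \<in> Z m" for x using that Suc.prems by auto
    show "finite (exponents s m)" by (rule finite_exponents)
    show "list_monomial g rs \<in> polyfun J" if "rs \<in> exponents s m" for rs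
      using that Suc.prems(3) by (intro polyfun_list_monomial) (auto simp: exponents_def)
    show "\<forall>rs\<in>exponents s m. c' rs = 0"
      if "\<And>x. x \<in> Z m \<Longrightarrow> (\<Sum>rs\<in>exponents s m. c' rs * list_monomial g rs x) = 0" for c'
      using that Suc.prems by (intro Suc.IH) auto
    fix x assume x: "x \<in> Z (Suc m)"
    have "(\<Sum>rs\<in>exponents s (Suc m). c rs * list_monomial g rs x)
        = (\<Sum>(r, rs)\<in>{..<s} \<times> exponents s m. c (r # rs) * list_monomial g (r # rs) x)"
      unfolding exponents_Suc by (subst sum.reindex) (auto simp: inj_on_def o_def case_prod_unfold)
    also have "\<dots> = (\<Sum>r<s. \<Sum>rs\<in>exponents s m. c (r # rs) * list_monomial g (r # rs) x)"
      by (simp add: sum.cartesian_product)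
    also have "\<dots> = (\<Sum>r<s. g m x ^ r * (\<Sum>rs\<in>exponents s m. c (r # rs) * list_monomial g rs x))"
      by (auto simp: sum_distrib_left exponents_def algebra_simps intro!: sum.cong)
    finally show "(\<Sum>r<s. g m x ^ r * (\<Sum>rs\<in>exponents s m. c (r # rs) * list_monomial g rs x)) = 0"
      using Suc.prems(6)[OF x] by simp
  qed
  then show ?case by (auto simp: exponents_Suc)
qed

section \<open>The length of chains of irreducible closed sets\<close>

text \<open>
  The bound is imposed on each exponent separately rather than on the total degree: the number of
  monomials is then at most a plain power, which is all that the growth comparison needs.
\<close>
definition box_monomials :: "'a set \<Rightarrow> nat \<Rightarrow> (('a \<Rightarrow> complex) \<Rightarrow> complex) set" where
  "box_monomials J N = (\<lambda>a x. \<Prod>j\<in>J. x j ^ a j) ` (J \<rightarrow>\<^sub>E {..N})"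

lemma finite_box_monomials: "finite J \<Longrightarrow> finite (box_monomials J N)"
  by (simp add: box_monomials_def finite_PiE)

lemma card_box_monomials: "finite J \<Longrightarrow> card (box_monomials J N) \<le> (N + 1) ^ card J"
  unfolding box_monomials_def
  by (rule order.trans[OF card_image_le]) (auto simp: finite_PiE card_PiE)

lemma box_monomialsI:
  assumes "finite J" "\<And>j. j \<in> J \<Longrightarrow> a j \<le> N"
  shows "(\<lambda>x. \<Prod>j\<in>J. x j ^ a j) \<in> box_monomials J N"
  unfolding box_monomials_def
  by (rule image_eqI[of _ _ "restrict a J"]) (use assms in auto)

lemma span_box_monomials_mono:
  assumes "N \<le> M" shows "cvec.span (box_monomials J N) \<subseteq> cvec.span (box_monomials J M)"
proof (rule cvec.span_mono)
  have "(J \<rightarrow>\<^sub>E {..N}) \<subseteq> (J \<rightarrow>\<^sub>E {..M})" using assms by (intro PiE_mono) auto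
  then show "box_monomials J N \<subseteq> box_monomials J M" unfolding box_monomials_def by blast
qed

lemma span_box_monomials_mult:
  assumes J: "finite J" and u: "u \<in> cvec.span (box_monomials J N)" and v: "v \<in> cvec.span (box_monomials J M)"
  shows "(\<lambda>x. u x * v x) \<in> cvec.span (box_monomials J (N + M))"
proof -
  let ?S = "cvec.span (box_monomials J (N + M))"
  have base: "(\<lambda>x. p x * q x) \<in> ?S" if "p \<in> box_monomials J N" "q \<in> box_monomials J M" for p q
  proof -
    obtain a b where "a \<in> J \<rightarrow>\<^sub>E {..N}" "p = (\<lambda>x. \<Prod>j\<in>J. x j ^ a j)"
      "b \<in> J \<rightarrow>\<^sub>E {..M}" "q = (\<lambda>x. \<Prod>j\<in>J. x j ^ b j)"
      using \<open>p \<in> _\<close> \<open>q \<in> _\<close> by (auto simp: box_monomials_def)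
    then show ?thesis
      using box_monomialsI[OF J, of "\<lambda>j. a j + b j" "N + M"]
      by (auto intro!: cvec.span_base simp: prod.distrib power_add PiE_def Pi_def add_mono)
  qed
  have left: "(\<lambda>x. u x * q x) \<in> ?S" if q: "q \<in> box_monomials J M" for q
    using u
  proof (induction rule: cvec.span_induct_alt)
    case base
    show ?case using cvec.span_zero[of "box_monomials J (N + M)"] by (simp add: zero_fun_def)
  next
    case (step c p y)
    have "(\<lambda>x. ((\<lambda>j. c * p j) + y) x * q x) = (\<lambda>x. c * (p x * q x)) + (\<lambda>x. y x * q x)"
      by (auto simp: fun_eq_iff algebra_simps)
    then show ?case using cvec.span_add[OF cvec.span_scale[OF base[OF step(1) q], of c] step(2)] by simp
  qed
  show ?thesis using v
  proof (induction rule: cvec.span_induct_alt)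
    case base
    show ?case using cvec.span_zero[of "box_monomials J (N + M)"] by (simp add: zero_fun_def)
  next
    case (step c q y)
    have "(\<lambda>x. u x * ((\<lambda>j. c * q j) + y) x) = (\<lambda>x. c * (u x * q x)) + (\<lambda>x. u x * y x)"
      by (auto simp: fun_eq_iff algebra_simps)
    then show ?case using cvec.span_add[OF cvec.span_scale[OF left[OF step(1)], of c] step(2)] by simp
  qed
qed

lemma const_in_span_box_monomials:
  assumes "finite J" shows "(\<lambda>x. c) \<in> cvec.span (box_monomials J N)"
proof -
  have "(\<lambda>x. \<Prod>j\<in>J. x j ^ 0) \<in> box_monomials J N" by (rule box_monomialsI[OF assms]) auto
  then have "(\<lambda>x. 1) \<in> cvec.span (box_monomials J N)" by (simp add: cvec.span_base)
  from cvec.span_scale[OF this, of c] show ?thesis by simp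
qed

lemma span_box_monomials_power:
  assumes J: "finite J" and u: "u \<in> cvec.span (box_monomials J N)"
  shows "(\<lambda>x. u x ^ r) \<in> cvec.span (box_monomials J (r * N))"
  by (induction r)
    (auto intro: const_in_span_box_monomials[OF J] span_box_monomials_mult[OF J u])

lemma polyfun_in_span_box_monomials:
  assumes J: "finite J" and "g \<in> polyfun J"
  shows "\<exists>N. g \<in> cvec.span (box_monomials J N)"
  using assms(2)
proof induction
  case (const c)
  then show ?case using const_in_span_box_monomials[OF J] by blast
next
  case (coord j)
  have "(\<lambda>x::'a \<Rightarrow> complex. \<Prod>i\<in>J. x i ^ (if i = j then 1 else 0)) \<in> box_monomials J 1"
    by (rule box_monomialsI[OF J]) auto
  moreover have "(\<lambda>x::'a \<Rightarrow> complex. \<Prod>i\<in>J. x i ^ (if i = j then 1 else 0)) = (\<lambda>x. x j)"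
  proof
    fix x :: "'a \<Rightarrow> complex"
    have "(\<Prod>i\<in>J. x i ^ (if i = j then 1 else 0)) = (\<Prod>i\<in>J. if i = j then x i else 1)"
      by (rule prod.cong) auto
    also have "\<dots> = x j" using J coord by simp
    finally show "(\<Prod>i\<in>J. x i ^ (if i = j then 1 else 0)) = x j" .
  qed
  ultimately show ?case by (metis cvec.span_base)
next
  case (add g h)
  then obtain N M where "g \<in> cvec.span (box_monomials J N)" "h \<in> cvec.span (box_monomials J M)" by blast
  then have "g \<in> cvec.span (box_monomials J (N + M))" "h \<in> cvec.span (box_monomials J (N + M))"
    using span_box_monomials_mono[of N "N + M" J] span_box_monomials_mono[of M "N + M" J] by auto
  from cvec.span_add[OF this] show ?case unfolding plus_fun_def by blast
next
  case (mult g h)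
  then show ?case using span_box_monomials_mult[OF J] by blast
qed

lemma list_monomial_in_span_box_monomials:
  assumes J: "finite J" and "\<And>i. i < length rs \<Longrightarrow> g i \<in> cvec.span (box_monomials J e)"
    and "set rs \<subseteq> {..<s}"
  shows "list_monomial g rs \<in> cvec.span (box_monomials J (length rs * (s * e)))"
  using assms(2,3)
proof (induction rs)
  case Nil
  have "list_monomial g [] = (\<lambda>x. 1)" by auto
  then show ?case using const_in_span_box_monomials[OF J] by metis
next
  case (Cons r rs)
  have "(\<lambda>x. g (length rs) x ^ r) \<in> cvec.span (box_monomials J (r * e))"
    using Cons.prems by (intro span_box_monomials_power J) auto
  moreover have "r * e \<le> s * e" using Cons.prems by auto
  ultimately have "(\<lambda>x. g (length rs) x ^ r) \<in> cvec.span (box_monomials J (s * e))"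
    using span_box_monomials_mono by blast
  moreover have "list_monomial g rs \<in> cvec.span (box_monomials J (length rs * (s * e)))"
    using Cons by auto
  ultimately have "(\<lambda>x. g (length rs) x ^ r * list_monomial g rs x)
      \<in> cvec.span (box_monomials J (s * e + length rs * (s * e)))"
    by (rule span_box_monomials_mult[OF J])
  moreover have "list_monomial g (r # rs) = (\<lambda>x. g (length rs) x ^ r * list_monomial g rs x)" by auto
  ultimately show ?case by simp
qed

lemma fun_sum_apply: "(\<Sum>i\<in>I. f i) x = (\<Sum>i\<in>I. f i x)" for f :: "'i \<Rightarrow> 'x \<Rightarrow> complex"
  by (induction I rule: infinite_finite_induct) auto

text \<open>
  Independence is stated for the family, not for its set of values; two indices with the same
  function would violate it by the relation with coefficients \<open>1\<close> and \<open>-1\<close>.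
\<close>
lemma independent_family_card_le:
  fixes u :: "'i \<Rightarrow> 'x \<Rightarrow> complex"
  assumes I: "finite I" and T: "finite T" and uT: "\<And>a. a \<in> I \<Longrightarrow> u a \<in> cvec.span T"
    and ind: "\<And>c. (\<And>x. (\<Sum>a\<in>I. c a * u a x) = 0) \<Longrightarrow> \<forall>a\<in>I. c a = 0"
  shows "card I \<le> card T"
proof -
  have inj: "inj_on u I"
  proof (rule inj_onI, rule ccontr)
    fix a b assume ab: "a \<in> I" "b \<in> I" "u a = u b" "a \<noteq> b"
    define c where "c i = (if i = a then 1 else if i = b then -1 else 0 :: complex)" for i
    have "(\<Sum>i\<in>I. c i * u i x) = 0" for x
    proof -
      have "(\<Sum>i\<in>I. c i * u i x) = (\<Sum>i\<in>{a, b}. c i * u i x)"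
        using ab I by (intro sum.mono_neutral_right) (auto simp: c_def)
      also have "\<dots> = 0" using ab by (simp add: c_def)
      finally show ?thesis .
    qed
    from ind[OF this] ab show False by (auto simp: c_def)
  qed
  have "cvec.independent (u ` I)"
  proof
    assume "cvec.dependent (u ` I)"
    then obtain w where w: "\<exists>v\<in>u ` I. w v \<noteq> 0" "(\<Sum>v\<in>u ` I. (\<lambda>j. w v * v j)) = 0"
      using cvec.dependent_finite[of "u ` I"] I by auto
    have "(\<Sum>a\<in>I. w (u a) * u a x) = 0" for x
    proof -
      have "(\<Sum>v\<in>u ` I. (\<lambda>j. w v * v j)) x = (\<Sum>a\<in>I. w (u a) * u a x)"
        by (simp add: sum.reindex[OF inj] fun_sum_apply)
      then show ?thesis using w(2) by simp
    qed
    from ind[OF this] w(1) show False by auto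
  qed
  from cvec.independent_span_bound[OF T this] uT show ?thesis
    by (auto simp: card_image[OF inj] image_subset_iff)
qed

lemma choice_lessThan: "(\<And>i. i < m \<Longrightarrow> \<exists>y. P i y) \<Longrightarrow> \<exists>f. \<forall>i<m. P i (f i)" for m :: nat
  by (rule choice[of "\<lambda>i y. i < m \<longrightarrow> P i y"]) blast

text \<open>
  This is the bound of the Krull dimension of \<open>\<complex>\<^sup>J\<close> by the number of coordinates. For each step of the
  chain choose a polynomial \<open>g\<^sub>i\<close> that vanishes on \<open>Z\<^sub>i\<close> but not on \<open>Z\<^bsub>i+1\<^esub>\<close>. The \<open>s\<^sup>m\<close> monomials in these
  functions with exponents below \<open>s\<close> are linearly independent on \<open>Z\<^sub>m\<close>, and they lie in the span
  of the monomials in the coordinates with exponents \<open>O(s)\<close>, of which there are \<open>O(s\<^sup>d)\<close> with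
  \<open>d = card J\<close>. For large \<open>s\<close> this forces \<open>m \<le> d\<close>.
\<close>
lemma irreducible_chain_length_le:
  assumes J: "finite J"
    and Z: "\<And>i. i \<le> m \<Longrightarrow> irreducible_closed J (Z i)" "\<And>i. i < m \<Longrightarrow> Z i \<subset> Z (Suc i)"
  shows "m \<le> card J"
proof (rule ccontr)
  assume "\<not> m \<le> card J"
  define d where "d = card J"
  have "\<exists>g. \<forall>i<m. g i \<in> polyfun J \<and> (\<forall>x\<in>Z i. g i x = 0) \<and> (\<exists>x\<in>Z (Suc i). g i x \<noteq> 0)"
  proof (intro choice_lessThan)
    fix i assume i: "i < m"
    show "\<exists>g. g \<in> polyfun J \<and> (\<forall>x\<in>Z i. g x = 0) \<and> (\<exists>x\<in>Z (Suc i). g x \<noteq> 0)"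
    proof -
      obtain x where x: "x \<in> Z (Suc i)" "x \<notin> Z i" using Z(2)[OF i] by blast
      have irr: "irreducible_closed J (Z i)" "irreducible_closed J (Z (Suc i))" using Z(1) i by simp_all
      have "x \<in> cspace J" using irreducible_closed_subset_cspace[OF irr(2)] x(1) by blast
      moreover have "zariski_closed J (Z i)" using irr(1) by (simp add: irreducible_closed_def)
      ultimately obtain g where "g \<in> polyfun J" "\<And>y. y \<in> Z i \<Longrightarrow> g y = 0" "g x \<noteq> 0"
        using zariski_closed_separation x(2) by blast
      then show ?thesis using x(1) by blast
    qed
  qed
  then obtain g where g: "\<And>i. i < m \<Longrightarrow> g i \<in> polyfun J" "\<And>i x. i < m \<Longrightarrow> x \<in> Z i \<Longrightarrow> g i x = 0"
    "\<And>i. i < m \<Longrightarrow> \<exists>x\<in>Z (Suc i). g i x \<noteq> 0" by blast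
  have "\<exists>N. \<forall>i<m. g i \<in> cvec.span (box_monomials J (N i))"
    by (intro choice_lessThan polyfun_in_span_box_monomials[OF J] g(1))
  then obtain N where N: "\<And>i. i < m \<Longrightarrow> g i \<in> cvec.span (box_monomials J (N i))"
    by blast
  define e where "e = (\<Sum>i<m. N i)"
  have ge: "g i \<in> cvec.span (box_monomials J e)" if "i < m" for i
  proof -
    have "N i \<le> e" unfolding e_def using that by (intro member_le_sum) auto
    then show ?thesis using N[OF that] span_box_monomials_mono by blast
  qed
  have bound: "s ^ m \<le> (m * (s * e) + 1) ^ d" for s
  proof -
    have "card (exponents s m) \<le> card (box_monomials J (m * (s * e)))"
    proof (rule independent_family_card_le[where u = "list_monomial g"])
      show "finite (exponents s m)" "finite (box_monomials J (m * (s * e)))"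
        using finite_exponents finite_box_monomials[OF J] by auto
      show "list_monomial g rs \<in> cvec.span (box_monomials J (m * (s * e)))" if "rs \<in> exponents s m" for rs
        using that list_monomial_in_span_box_monomials[OF J, of rs g e s] ge by (auto simp: exponents_def)
      show "\<forall>rs\<in>exponents s m. c rs = 0"
        if "\<And>x. (\<Sum>rs\<in>exponents s m. c rs * list_monomial g rs x) = 0" for c
        using that Z g by (intro chain_monomials_independent[where J = J and Z = Z and g = g]) auto
    qed
    also have "\<dots> \<le> (m * (s * e) + 1) ^ d" unfolding d_def by (rule card_box_monomials[OF J])
    finally show ?thesis by (simp add: card_exponents)
  qed
  \<comment> \<open>If \<open>m > d\<close>, the bound gives \<open>s ^ (d + 1) \<le> s ^ d * (m * e + 1) ^ d\<close>, which fails for this \<open>s\<close>.\<close>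
  define s where "s = (m * e + 1) ^ d + 1"
  have "s ^ d * s \<le> s ^ m"
    using \<open>\<not> m \<le> card J\<close> power_increasing[of "Suc d" m s] by (simp add: s_def d_def mult.commute)
  also have "\<dots> \<le> (m * (s * e) + 1) ^ d" by (rule bound)
  also have "\<dots> \<le> (s * (m * e + 1)) ^ d"
    by (intro power_mono) (auto simp: algebra_simps s_def)
  also have "\<dots> = s ^ d * (m * e + 1) ^ d" by (rule power_mult_distrib)
  finally have "s \<le> (m * e + 1) ^ d" by (simp add: s_def)
  then show False by (simp add: s_def)
qed

section \<open>Smoothness of linear subspaces and of cones\<close>

lemma unit_vec_in_cspace: "j \<in> J \<Longrightarrow> unit_vec j \<in> cspace J"
  by (auto simp: unit_vec_def cspace_def)

lemma cspace_expansion: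
  assumes "finite J" "y \<in> cspace J"
  shows "y = (\<Sum>j\<in>J. (\<lambda>i. y j * unit_vec j i))"
proof
  fix i
  have "(\<Sum>j\<in>J. (\<lambda>i. y j * unit_vec j i)) i = (\<Sum>j\<in>J. if i = j then y j else 0)"
    by (auto simp: fun_sum_apply unit_vec_def intro!: sum.cong)
  also have "\<dots> = y i" using assms by (auto simp: cspace_def)
  finally show "y i = (\<Sum>j\<in>J. (\<lambda>i. y j * unit_vec j i)) i" by simp
qed

lemma span_unit_vec:
  assumes "finite J" shows "cvec.span (unit_vec ` J) = cspace J"
proof (rule cvec.span_subspace)
  show "unit_vec ` J \<subseteq> cspace J" by (auto intro: unit_vec_in_cspace)
  show "cspace J \<subseteq> cvec.span (unit_vec ` J)"
  proof
    fix y :: "'a \<Rightarrow> complex" assume "y \<in> cspace J"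
    then show "y \<in> cvec.span (unit_vec ` J)"
      by (subst cspace_expansion[OF assms], assumption)
        (intro cvec.span_sum cvec.span_scale cvec.span_base imageI)
  qed
  show "cvec.subspace (cspace J)" by (rule subspace_cspace)
qed

lemma independent_unit_vec: "cvec.independent (unit_vec ` J)"
proof
  assume "cvec.dependent (unit_vec ` J)"
  then obtain j where j: "unit_vec j \<in> cvec.span (unit_vec ` J - {unit_vec j})"
    by (auto simp: cvec.dependent_def)
  have "cvec.span (unit_vec ` J - {unit_vec j}) \<subseteq> {v. v j = 0}"
    by (rule cvec.span_minimal) (auto simp: cvec.subspace_def unit_vec_def)
  with j show False by (auto simp: unit_vec_def)
qed

lemma dim_cspace:
  assumes "finite J" shows "cvec.dim (cspace J) = card J"
proof -
  have "inj_on unit_vec J" by (auto simp: inj_on_def unit_vec_def fun_eq_iff split: if_splits)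
  then have "card (unit_vec ` J) = card J" by (rule card_image)
  then show ?thesis
    using cvec.dim_span_eq_card_independent[OF independent_unit_vec[of J]] by (simp add: span_unit_vec[OF assms, symmetric])
qed

lemma finite_independent_in_cspace:
  "finite J \<Longrightarrow> cvec.independent B \<Longrightarrow> B \<subseteq> cspace J \<Longrightarrow> finite B"
  using cvec.independent_span_bound[of "unit_vec ` J" B] by (simp add: span_unit_vec)

text \<open>
  Extend a basis of \<open>L\<close> together with \<open>x\<close> to a basis of the whole space; the coordinate that
  belongs to \<open>x\<close> is the required form.
\<close>
lemma separating_linear_form:
  assumes J: "finite J" and L: "cvec.subspace L" "L \<subseteq> cspace J" and x: "x \<in> cspace J" "x \<notin> L"
  obtains c where "\<And>y. y \<in> L \<Longrightarrow> (\<Sum>j\<in>J. c j * y j) = 0" "(\<Sum>j\<in>J. c j * x j) \<noteq> 0"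
proof -
  obtain B where B: "B \<subseteq> L" "cvec.independent B" "L \<subseteq> cvec.span B"
    using cvec.maximal_independent_subset by blast
  have "cvec.span B \<subseteq> L" using B(1) L(1) by (rule cvec.span_minimal)
  then have "cvec.independent (insert x B)"
    using B(2) x(2) by (intro cvec.independent_insertI) auto
  define E where "E = cvec.extend_basis (insert x B)"
  have E: "cvec.independent E" "cvec.span E = UNIV" "insert x B \<subseteq> E"
    using cvec.independent_extend_basis[OF \<open>cvec.independent (insert x B)\<close>]
      cvec.span_extend_basis[OF \<open>cvec.independent (insert x B)\<close>]
      cvec.extend_basis_superset[OF \<open>cvec.independent (insert x B)\<close>] by (auto simp: E_def)
  define D where "D v = cvec.representation E v x" for v
  have add: "D (u + v) = D u + D v" and scale: "D (\<lambda>j. a * v j) = a * D v" for u v a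
    using cvec.representation_add[OF E(1), of v u] cvec.representation_scale[OF E(1), of v a] E(2)
    by (auto simp: D_def)
  have D0: "D 0 = 0" using scale[of 0] by (simp add: zero_fun_def)
  have Dsum: "D (\<Sum>i\<in>I. f i) = (\<Sum>i\<in>I. D (f i))" for I and f :: "'a \<Rightarrow> 'a \<Rightarrow> complex"
    by (simp add: D_def cvec.representation_sum[OF E(1)] E(2))
  have D_eq: "D y = (\<Sum>j\<in>J. D (unit_vec j) * y j)" if "y \<in> cspace J" for y
    by (subst cspace_expansion[OF J that]) (simp add: Dsum scale mult.commute)
  have "D b = 0" if "b \<in> B" for b
  proof -
    have "b \<in> E" "b \<noteq> x" using that E x(2) B(1) by blast+
    then show ?thesis using cvec.representation_basis[OF E(1), of b] by (simp add: D_def)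
  qed
  moreover have "cvec.subspace {v. D v = 0}"
    using add D0 scale by (auto simp: cvec.subspace_def)
  ultimately have "cvec.span B \<subseteq> {v. D v = 0}" by (intro cvec.span_minimal) auto
  then have "D y = 0" if "y \<in> L" for y using that B(3) by blast
  moreover have "D x = 1"
    using E cvec.representation_basis[OF E(1), of x] by (auto simp: D_def)
  ultimately show ?thesis using that[of "\<lambda>j. D (unit_vec j)"] D_eq x(1) L(2) by (auto simp: subset_iff)
qed

lemma linear_form_polyfun: "finite J \<Longrightarrow> (\<lambda>y. \<Sum>j\<in>J. c j * y j) \<in> polyfun J"
  by (intro polyfun_sum polyfun.intros)

lemma zariski_closed_subspace:
  assumes J: "finite J" and L: "cvec.subspace L" "L \<subseteq> cspace J"
  shows "zariski_closed J L"
proof -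
  have "L = {x \<in> cspace J. \<forall>g\<in>vanishing_ideal J L. g x = 0}"
  proof (intro equalityI subsetI)
    fix x assume x: "x \<in> {x \<in> cspace J. \<forall>g\<in>vanishing_ideal J L. g x = 0}"
    show "x \<in> L"
    proof (rule ccontr)
      assume "x \<notin> L"
      then obtain c where "\<And>y. y \<in> L \<Longrightarrow> (\<Sum>j\<in>J. c j * y j) = 0" "(\<Sum>j\<in>J. c j * x j) \<noteq> 0"
        using separating_linear_form[OF J L] x by blast
      then show False using x linear_form_polyfun[OF J, of c]
        by (auto simp: vanishing_ideal_def)
    qed
  qed (use L in \<open>auto simp: vanishing_ideal_def\<close>)
  then show ?thesis unfolding zariski_closed_def
    by (intro exI[of _ "vanishing_ideal J L"]) (auto simp: vanishing_ideal_def)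
qed

text \<open>
  If \<open>L\<close> were the union of two proper closed subsets, join a point outside the first to a point
  outside the second by a line. Polynomials witnessing this restrict to nonzero polynomials in one
  variable whose product vanishes at every parameter, which is impossible.
\<close>
lemma irreducible_closed_subspace:
  assumes J: "finite J" and L: "cvec.subspace L" "L \<subseteq> cspace J"
  shows "irreducible_closed J L"
  unfolding irreducible_closed_def
proof (intro conjI allI impI)
  show "zariski_closed J L" by (rule zariski_closed_subspace[OF assms])
  show "L \<noteq> {}" using cvec.subspace_0[OF L(1)] by blast
  fix A B assume A: "zariski_closed J A" and B: "zariski_closed J B" and AB: "L = A \<union> B"
  show "L = A \<or> L = B"
  proof (rule ccontr)
    assume "\<not> (L = A \<or> L = B)"
    then obtain x y where x: "x \<in> L" "x \<notin> A" and y: "y \<in> L" "y \<notin> B" using AB by blast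
    obtain g where g: "g \<in> polyfun J" "\<And>y. y \<in> A \<Longrightarrow> g y = 0" "g x \<noteq> 0"
      using zariski_closed_separation[OF A _ x(2)] x(1) L(2) by blast
    obtain h where h: "h \<in> polyfun J" "\<And>y. y \<in> B \<Longrightarrow> h y = 0" "h y \<noteq> 0"
      using zariski_closed_separation[OF B _ y(2)] y(1) L(2) by blast
    let ?line = "\<lambda>t j. x j + t * (y - x) j"
    obtain q where q: "g (?line t) = poly q t" for t using polyfun_on_line[OF g(1)] by metis
    obtain r where r: "h (?line t) = poly r t" for t using polyfun_on_line[OF h(1)] by metis
    have "poly (q * r) t = 0" for t
    proof -
      have "?line t = x + (\<lambda>j. t * (y - x) j)" by (simp add: fun_eq_iff)
      moreover have "y - x \<in> L" using x y cvec.subspace_diff[OF L(1)] by blast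
      ultimately have "?line t \<in> L"
        using cvec.subspace_add[OF L(1) x(1) cvec.subspace_scale[OF L(1)], of "y - x" t] by simp
      then have "g (?line t) * h (?line t) = 0" using AB g(2) h(2) by auto
      then show ?thesis using q r by simp
    qed
    then have "q * r = 0" using poly_all_0_iff_0 by blast
    moreover have "poly q 0 \<noteq> 0" using q[of 0] g(3) by simp
    moreover have "poly r 1 \<noteq> 0" using r[of 1] h(3) by simp
    ultimately show False by auto
  qed
qed

lemma flag_between:
  assumes J: "finite J" and L: "cvec.subspace L" and M: "cvec.subspace M" "M \<subseteq> cspace J" and LM: "L \<subseteq> M"
  obtains n F where "n + cvec.dim L = cvec.dim M" "F 0 = L" "F n = M"
    "\<forall>i. cvec.subspace (F i) \<and> L \<subseteq> F i \<and> F i \<subseteq> M" "\<forall>i<n. F i \<subset> F (Suc i)"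
proof -
  obtain B where B: "B \<subseteq> L" "cvec.independent B" "L \<subseteq> cvec.span B"
    using cvec.maximal_independent_subset by blast
  obtain C where C: "B \<subseteq> C" "C \<subseteq> M" "cvec.independent C" "M \<subseteq> cvec.span C"
    using cvec.maximal_independent_subset_extend[of B M] B LM by blast
  have spans: "cvec.span B = L" "cvec.span C = M"
    using cvec.span_subspace[OF B(1,3) L] cvec.span_subspace[OF C(2,4) M(1)] by simp_all
  have fC: "finite C" using finite_independent_in_cspace[OF J C(3)] C(2) M(2) by blast
  then have fB: "finite B" using C(1) finite_subset by blast
  obtain cs where cs: "set cs = C - B" "distinct cs"
    using finite_distinct_list[of "C - B"] fC by blast
  define F where "F i = cvec.span (B \<union> set (take i cs))" for i
  have sub: "B \<union> set (take i cs) \<subseteq> C" for i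
    using set_take_subset[of i cs] cs C(1) by blast
  show ?thesis
  proof
    show "length cs + cvec.dim L = cvec.dim M"
      using cvec.basis_card_eq_dim[OF B(1,3,2)] cvec.basis_card_eq_dim[OF C(2,4,3)]
        distinct_card[OF cs(2)] card_mono[OF fC C(1)] by (simp add: cs card_Diff_subset[OF fB C(1)])
    show "F 0 = L" by (simp add: F_def spans)
    have "B \<union> set cs = C" using cs C(1) by blast
    then show "F (length cs) = M" by (simp add: F_def spans)
    show "\<forall>i. cvec.subspace (F i) \<and> L \<subseteq> F i \<and> F i \<subseteq> M"
    proof (intro allI conjI)
      fix i
      show "cvec.subspace (F i)" by (simp add: F_def)
      show "L \<subseteq> F i" unfolding F_def spans(1)[symmetric] by (rule cvec.span_mono) blast
      show "F i \<subseteq> M" unfolding F_def spans(2)[symmetric] by (rule cvec.span_mono) (rule sub)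
    qed
    show "\<forall>i<length cs. F i \<subset> F (Suc i)"
    proof (intro allI impI)
      fix i assume i: "i < length cs"
      have set_Suc: "set (take (Suc i) cs) = insert (cs ! i) (set (take i cs))"
        using i by (simp add: take_Suc_conv_app_nth)
      have "F i \<subseteq> F (Suc i)" unfolding F_def set_Suc by (rule cvec.span_mono) blast
      moreover have "cs ! i \<in> F (Suc i)" unfolding F_def set_Suc by (rule cvec.span_base) blast
      moreover have "cs ! i \<notin> F i"
      proof
        assume "cs ! i \<in> F i"
        have "cs ! i \<in> C - B" using i cs nth_mem by blast
        moreover have "cs ! i \<notin> set (take i cs)"
          using cs(2) i by (auto simp: in_set_conv_nth nth_eq_iff_index_eq)
        ultimately have "B \<union> set (take i cs) \<subseteq> C - {cs ! i}" using sub[of i] by blast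
        then have "F i \<subseteq> cvec.span (C - {cs ! i})" unfolding F_def by (rule cvec.span_mono)
        with \<open>cs ! i \<in> F i\<close> \<open>cs ! i \<in> C - B\<close> C(3) show False by (auto simp: cvec.dependent_def)
      qed
      ultimately show "F i \<subset> F (Suc i)" by blast
    qed
  qed
qed

text \<open>
  The chain is continued above \<open>L\<close> by a flag of linear subspaces that ends with the whole space; the
  bound for chains in the whole space then leaves at most \<open>dim L\<close> steps for the chain below.
\<close>
lemma irreducible_chain_in_subspace_length_le:
  assumes J: "finite J" and L: "cvec.subspace L" "L \<subseteq> cspace J"
    and Z: "\<And>i. i \<le> d \<Longrightarrow> irreducible_closed J (Z i)" "\<And>i. i < d \<Longrightarrow> Z i \<subset> Z (Suc i)"
    and ZL: "Z d \<subseteq> L"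
  shows "d \<le> cvec.dim L"
proof -
  obtain n F where F: "n + cvec.dim L = cvec.dim (cspace J)" "F 0 = L" "F n = cspace J"
    "\<forall>i. cvec.subspace (F i) \<and> L \<subseteq> F i \<and> F i \<subseteq> cspace J" "\<forall>i<n. F i \<subset> F (Suc i)"
    using flag_between[OF J L(1) subspace_cspace order.refl L(2)] by blast
  define W where "W i = (if i \<le> d then Z i else F (i - d))" for i
  have "d + n \<le> card J"
  proof (rule irreducible_chain_length_le[OF J, of _ W])
    show "irreducible_closed J (W i)" if "i \<le> d + n" for i
      using Z(1)[of i] F(4) irreducible_closed_subspace[OF J] by (simp add: W_def)
    fix i assume "i < d + n"
    then consider "i < d" | "i = d" "0 < n" | "d < i" "i - d < n" by linarith
    then show "W i \<subset> W (Suc i)"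
    proof cases
      case 1
      then show ?thesis using Z(2) by (simp add: W_def)
    next
      case 2
      then show ?thesis using ZL F(2) F(5) by (auto simp: W_def)
    next
      case 3
      then show ?thesis using F(5) by (simp add: W_def Suc_diff_le)
    qed
  qed
  then show ?thesis using F(1) dim_cspace[OF J] by linarith
qed

lemma local_dim_subspace:
  assumes J: "finite J" and L: "cvec.subspace L" "L \<subseteq> cspace J"
  shows "local_dim J L 0 = enat (cvec.dim L)"
proof (rule antisym)
  show "local_dim J L 0 \<le> enat (cvec.dim L)"
    unfolding local_dim_def
  proof (rule Sup_least, clarsimp)
    fix d and Z :: "nat \<Rightarrow> ('a \<Rightarrow> complex) set"
    assume "\<forall>i\<le>d. irreducible_closed J (Z i) \<and> 0 \<in> Z i \<and> Z i \<subseteq> L" "\<forall>i<d. Z i \<subset> Z (Suc i)"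
    then show "d \<le> cvec.dim L"
      by (intro irreducible_chain_in_subspace_length_le[OF J L, of d Z]) auto
  qed
  have "0 \<in> L" using L(1) by (rule cvec.subspace_0)
  then have "{0} \<subseteq> L" by simp
  obtain n F where F: "n + cvec.dim {0 :: 'a \<Rightarrow> complex} = cvec.dim L" "F 0 = {0}" "F n = L"
    "\<forall>i. cvec.subspace (F i) \<and> {0} \<subseteq> F i \<and> F i \<subseteq> L" "\<forall>i<n. F i \<subset> F (Suc i)"
    using flag_between[OF J cvec.subspace_single_0 L \<open>{0} \<subseteq> L\<close>] by blast
  have "cvec.dim {0 :: 'a \<Rightarrow> complex} = 0"
    by (rule cvec.dim_unique[of "{}"]) (auto simp: cvec.independent_empty)
  then have "n = cvec.dim L" using F(1) by simp
  show "enat (cvec.dim L) \<le> local_dim J L 0"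
    unfolding local_dim_def
  proof (rule Sup_upper, intro CollectI exI conjI)
    show "\<forall>i\<le>cvec.dim L. irreducible_closed J (F i) \<and> 0 \<in> F i \<and> F i \<subseteq> L"
    proof (intro allI impI conjI)
      fix i
      show "irreducible_closed J (F i)"
        using F(4) L(2) by (intro irreducible_closed_subspace[OF J]) blast+
      show "0 \<in> F i" "F i \<subseteq> L" using F(4) by simp_all
    qed
    show "\<forall>i<cvec.dim L. F i \<subset> F (Suc i)" using F(5) \<open>n = cvec.dim L\<close> by blast
  qed simp
qed

text \<open>
  For the nontrivial inclusion, a linear form that vanishes on \<open>L\<close> is its own differential, and such
  forms separate \<open>L\<close> from the points outside.
\<close>
lemma tangent_space_subspace:
  assumes J: "finite J" and L: "cvec.subspace L" "L \<subseteq> cspace J"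
  shows "tangent_space J L 0 = L"
proof (intro equalityI subsetI)
  fix v assume "v \<in> L"
  have "(\<lambda>t. g (\<lambda>j. 0 j + t * v j)) = (\<lambda>t. 0)" if "g \<in> vanishing_ideal J L" for g
    using that cvec.subspace_scale[OF L(1) \<open>v \<in> L\<close>] by (auto simp: vanishing_ideal_def)
  then show "v \<in> tangent_space J L 0" using \<open>v \<in> L\<close> L(2) by (auto simp: tangent_space_def)
next
  fix v assume v: "v \<in> tangent_space J L 0"
  show "v \<in> L"
  proof (rule ccontr)
    assume "v \<notin> L"
    moreover have "v \<in> cspace J" using v by (simp add: tangent_space_def)
    ultimately obtain c where c: "\<And>y. y \<in> L \<Longrightarrow> (\<Sum>j\<in>J. c j * y j) = 0" "(\<Sum>j\<in>J. c j * v j) \<noteq> 0"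
      using separating_linear_form[OF J L] by blast
    let ?g = "\<lambda>y. \<Sum>j\<in>J. c j * y j"
    have mem: "?g \<in> vanishing_ideal J L" using c(1) linear_form_polyfun[OF J] by (simp add: vanishing_ideal_def)
    have "\<forall>g\<in>vanishing_ideal J L. ((\<lambda>t. g (\<lambda>j. 0 j + t * v j)) has_field_derivative 0) (at 0)"
      using v unfolding tangent_space_def by blast
    from bspec[OF this mem]
    have "((\<lambda>t. ?g (\<lambda>j. 0 j + t * v j)) has_field_derivative 0) (at 0)" .
    moreover have "(\<lambda>t. ?g (\<lambda>j. 0 j + t * v j)) = (\<lambda>t. t * ?g v)"
      by (simp add: sum_distrib_left algebra_simps)
    moreover have "((\<lambda>t. t * ?g v) has_field_derivative ?g v) (at 0)"
      by (auto intro!: derivative_eq_intros)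
    ultimately show False using c(2) DERIV_unique by metis
  qed
qed

lemma affine_smooth_at_subspace:
  assumes "finite J" "cvec.subspace L" "L \<subseteq> cspace J"
  shows "affine_smooth_at J L 0"
  using assms cvec.subspace_0 by (auto simp: affine_smooth_at_def local_dim_subspace tangent_space_subspace)

text \<open>
  Polynomials that vanish on a cone \<open>X\<close> vanish along the lines from \<open>0\<close> to the points of \<open>X\<close>, so
  \<open>X\<close> is contained in its tangent space \<open>T\<close> at \<open>0\<close>. If the inclusion were proper, the irreducible
  closed set \<open>T\<close> could be put on top of every chain in \<open>X\<close>, so that the dimension of \<open>X\<close> at \<open>0\<close>
  would be less than \<open>dim T\<close>, contrary to smoothness.
\<close>
lemma smooth_cone_subspace:
  assumes J: "finite J" and X: "X \<subseteq> cspace J"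
    and cone: "\<And>x t. x \<in> X \<Longrightarrow> (\<lambda>j. t * x j) \<in> X"
    and smooth: "affine_smooth_at J X 0"
  shows "cvec.subspace X"
proof -
  define T where "T = tangent_space J X 0"
  have T: "cvec.subspace T" "T \<subseteq> cspace J"
    unfolding T_def by (rule subspace_tangent_space) (auto simp: tangent_space_def)
  have dim: "local_dim J X 0 = enat (cvec.dim T)" using smooth by (simp add: affine_smooth_at_def T_def)
  have XT: "X \<subseteq> T"
  proof
    fix v assume "v \<in> X"
    have "(\<lambda>t. g (\<lambda>j. 0 j + t * v j)) = (\<lambda>t. 0)" if "g \<in> vanishing_ideal J X" for g
      using that cone[OF \<open>v \<in> X\<close>] by (auto simp: vanishing_ideal_def)
    then show "v \<in> T" using \<open>v \<in> X\<close> X by (auto simp: T_def tangent_space_def)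
  qed
  have "X = T"
  proof (rule ccontr)
    assume "X \<noteq> T"
    with XT have XT: "X \<subset> T" by blast
    have less: "d < cvec.dim T"
      if "\<forall>i\<le>d. irreducible_closed J (Z i) \<and> 0 \<in> Z i \<and> Z i \<subseteq> X" "\<forall>i<d. Z i \<subset> Z (Suc i)" for d Z
    proof -
      have "Suc d \<le> cvec.dim T"
      proof (rule irreducible_chain_in_subspace_length_le[OF J T, of _ "Z(Suc d := T)"])
        show "irreducible_closed J ((Z(Suc d := T)) i)" if "i \<le> Suc d" for i
          using that \<open>\<forall>i\<le>d. _\<close> irreducible_closed_subspace[OF J T] by auto
        show "(Z(Suc d := T)) i \<subset> (Z(Suc d := T)) (Suc i)" if "i < Suc d" for i
        proof (cases "i = d")
          case True
          then have "Z i \<subseteq> X" using \<open>\<forall>i\<le>d. _\<close> by simp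
          then show ?thesis using True XT by auto
        next
          case False
          then show ?thesis using that \<open>\<forall>i<d. _\<close> by simp
        qed
      qed simp
      then show ?thesis by simp
    qed
    have 0: "0 \<in> X" using smooth by (simp add: affine_smooth_at_def)
    \<comment> \<open>The chain that consists of the origin alone guards the subtraction \<open>dim T - 1\<close> below.\<close>
    have "0 < cvec.dim T"
    proof (rule less[of 0 "\<lambda>_. {0}"])
      show "\<forall>i\<le>0. irreducible_closed J {0} \<and> 0 \<in> {0::'a \<Rightarrow> complex} \<and> {0} \<subseteq> X"
        using irreducible_closed_subspace[OF J cvec.subspace_single_0] 0 X by auto
    qed simp
    have "local_dim J X 0 \<le> enat (cvec.dim T - 1)"
      unfolding local_dim_def
    proof (rule Sup_least, clarsimp)
      fix d and Z :: "nat \<Rightarrow> ('a \<Rightarrow> complex) set"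
      assume "\<forall>i\<le>d. irreducible_closed J (Z i) \<and> 0 \<in> Z i \<and> Z i \<subseteq> X" "\<forall>i<d. Z i \<subset> Z (Suc i)"
      from less[OF this] show "d \<le> cvec.dim T - Suc 0" by simp
    qed
    then show False using dim \<open>0 < cvec.dim T\<close> by simp
  qed
  then show ?thesis using T by simp
qed

section \<open>The torus action on positroid varieties\<close>

lemma cvec_module_hom:
  assumes "\<And>u v. f (u + v) = f u + f v" "\<And>c v. f (\<lambda>j. c * v j) = (\<lambda>j. c * f v j)"
  shows "module_hom (\<lambda>(c::complex) (v :: 'a \<Rightarrow> complex) j. c * v j)
    (\<lambda>(c::complex) (v :: 'b \<Rightarrow> complex) j. c * v j) f"
  using assms
  by (simp add: module_hom_iff cvec.module_axioms)

lemma cvec_dim_inj_image: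
  assumes f: "module_hom (\<lambda>(c::complex) (v :: 'a \<Rightarrow> complex) j. c * v j)
    (\<lambda>(c::complex) (v :: 'b \<Rightarrow> complex) j. c * v j) f" and "inj f"
  shows "cvec.dim (f ` V) = cvec.dim V"
proof -
  obtain B where B: "B \<subseteq> V" "cvec.independent B" "V \<subseteq> cvec.span B" "card B = cvec.dim V"
    by (rule cvec.basis_exists)
  show ?thesis
  proof (rule cvec.dim_unique[of "f ` B"])
    show "f ` B \<subseteq> f ` V" using B(1) by (rule image_mono)
    show "f ` V \<subseteq> cvec.span (f ` B)"
      unfolding module_hom.span_image[OF f] using B(3) by (rule image_mono)
    show "cvec.independent (f ` B)"
      using module_hom.independent_injective_image[OF f B(2)] inj_on_subset[OF \<open>inj f\<close>] by blast
    show "card (f ` B) = cvec.dim V"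
      using card_image[of f B] inj_on_subset[OF \<open>inj f\<close>] B(4) by simp
  qed
qed

definition column_scaling :: "('a \<Rightarrow> complex) \<Rightarrow> ('a \<Rightarrow> complex) \<Rightarrow> 'a \<Rightarrow> complex" where
  "column_scaling d v = (\<lambda>c. d c * v c)"

lemma module_hom_column_scaling:
  "module_hom (\<lambda>(c::complex) (v :: 'a \<Rightarrow> complex) j. c * v j)
    (\<lambda>(c::complex) (v :: 'a \<Rightarrow> complex) j. c * v j) (column_scaling d)"
  by (rule cvec_module_hom) (auto simp: column_scaling_def fun_eq_iff algebra_simps)

lemma inj_column_scaling: "(\<And>c. d c \<noteq> 0) \<Longrightarrow> inj (column_scaling d)"
  by (auto simp: inj_def column_scaling_def fun_eq_iff)

text \<open>
  The factor depends on the index and not on the vector, since equal vectors of the family may be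
  scaled differently.
\<close>
lemma span_scaled_family:
  fixes v :: "'i \<Rightarrow> 'a \<Rightarrow> complex"
  assumes "\<And>i. e i \<noteq> 0"
  shows "cvec.span ((\<lambda>i r. e i * v i r) ` I) = cvec.span (v ` I)"
proof (rule antisym; rule cvec.span_minimal)
  show "(\<lambda>i r. e i * v i r) ` I \<subseteq> cvec.span (v ` I)"
    by (clarsimp, intro cvec.span_scale cvec.span_base imageI)
  show "v ` I \<subseteq> cvec.span ((\<lambda>i r. e i * v i r) ` I)"
  proof
    fix w assume "w \<in> v ` I"
    then obtain i where i: "i \<in> I" "w = v i" by blast
    have "(\<lambda>r. inverse (e i) * (e i * v i r)) \<in> cvec.span ((\<lambda>i r. e i * v i r) ` I)"
      using i(1) by (intro cvec.span_scale cvec.span_base) blast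
    moreover have "(\<lambda>r. inverse (e i) * (e i * v i r)) = w" using assms i(2) by simp
    ultimately show "w \<in> cvec.span ((\<lambda>i r. e i * v i r) ` I)" by simp
  qed
qed (rule cvec.subspace_span)+

lemma row_span_scaling: "row_span k (\<lambda>r. column_scaling d (M r)) = column_scaling d ` row_span k M"
  unfolding row_span_def module_hom.span_image[OF module_hom_column_scaling, symmetric]
  by (simp add: image_image)

lemma column_rank_scaling:
  assumes "\<And>c. d c \<noteq> 0"
  shows "column_rank n (\<lambda>r. column_scaling d (M r)) i j = column_rank n M i j"
proof -
  have "periodic_column n (\<lambda>r. column_scaling d (M r))
      = (\<lambda>c r. d ((c - 1) mod int n + 1) * periodic_column n M c r)"
    by (auto simp: periodic_column_def column_scaling_def)
  then show ?thesis
    unfolding column_rank_def by (simp only: span_scaled_family[of "\<lambda>c. d ((c - 1) mod int n + 1)", OF assms])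
qed

lemma positroid_variety_scaling:
  assumes V: "V \<in> positroid_variety k n f" and d: "\<And>c. d c \<noteq> 0"
  shows "column_scaling d ` V \<in> positroid_variety k n f"
proof -
  obtain M where M: "V = row_span k M" "full_rank_matrix k n M"
    "\<forall>i j. i \<le> j \<and> j \<le> i + int n \<longrightarrow>
        int (column_rank n M i j) \<le> (j - i + 1) - int (card {a. a \<ge> i \<and> f a \<le> j})"
    using V by (auto simp: positroid_variety_def)
  let ?M = "\<lambda>r. column_scaling d (M r)"
  have "is_matrix k n ?M"
    using M(2) by (auto simp: full_rank_matrix_def is_matrix_def column_scaling_def)
  then have "full_rank_matrix k n ?M"
    using M(2) cvec_dim_inj_image[OF module_hom_column_scaling inj_column_scaling[OF d], where V = "row_span k M"]
    by (simp add: full_rank_matrix_def row_span_scaling)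
  moreover have "column_scaling d ` V = row_span k ?M" by (simp add: row_span_scaling M(1))
  ultimately show ?thesis
    using M(3) column_rank_scaling[OF d] unfolding positroid_variety_def mem_Collect_eq
    by (intro exI[of _ ?M]) simp
qed

lemma positroid_variety_subset_grassmannian: "positroid_variety k n f \<subseteq> grassmannian k n"
proof
  fix V assume "V \<in> positroid_variety k n f"
  then obtain M where M: "V = row_span k M" "full_rank_matrix k n M"
    by (auto simp: positroid_variety_def)
  have "M ` {1..k} \<subseteq> cspace {1..int n}"
    using M(2) by (auto simp: full_rank_matrix_def is_matrix_def cspace_def)
  then have "V \<subseteq> cspace {1..int n}"
    unfolding M(1) row_span_def using subspace_cspace by (rule cvec.span_minimal)
  then show "V \<in> grassmannian k n"
    using M by (simp add: grassmannian_def full_rank_matrix_def row_span_def)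
qed

section \<open>Charts at coordinate planes\<close>

definition chart_row :: "int set \<Rightarrow> (int \<times> int \<Rightarrow> complex) \<Rightarrow> int \<Rightarrow> int \<Rightarrow> complex" where
  "chart_row mu A r = (\<lambda>c. if c \<in> mu then (if c = r then 1 else 0) else A (r, c))"

lemma chart_point_eq: "chart_point mu A = cvec.span (chart_row mu A ` mu)"
  by (simp add: chart_point_def chart_row_def[abs_def])

lemma chart_point_0: "chart_point mu 0 = coord_plane mu"
proof -
  have "chart_row mu 0 ` mu = unit_vec ` mu"
    by (intro image_cong) (auto simp: chart_row_def unit_vec_def)
  then show ?thesis by (simp add: chart_point_eq coord_plane_def)
qed

text \<open>
  The plane of a chart point of \<open>mu\<close> has a vector with coordinate \<open>1\<close> at each given element of \<open>mu\<close>,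
  whereas \<open>coord_plane lam\<close> has only vectors supported on \<open>lam\<close>. So \<open>mu\<close> is contained in \<open>lam\<close>, and
  as the cardinalities agree, the two sets are equal.
\<close>
lemma chart_point_eq_coord_plane:
  assumes fin: "finite mu" "finite lam" and card: "card mu = card lam"
    and A: "A \<in> cspace (chart_coords n mu)" and eq: "chart_point mu A = coord_plane lam"
  shows "mu = lam \<and> A = 0"
proof -
  have row: "chart_row mu A r \<in> cspace lam" if "r \<in> mu" for r
    using that eq span_unit_vec[OF fin(2)] cvec.span_base[of "chart_row mu A r" "chart_row mu A ` mu"]
    by (auto simp: chart_point_eq coord_plane_def)
  have "mu \<subseteq> lam"
  proof
    fix r assume "r \<in> mu"
    then have "chart_row mu A r r = 1" by (simp add: chart_row_def)
    then show "r \<in> lam" using row[OF \<open>r \<in> mu\<close>] by (auto simp: cspace_def)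
  qed
  then have "mu = lam" using card fin by (intro card_subset_eq)
  moreover have "A (r, c) = 0" for r c
  proof (cases "r \<in> mu \<and> c \<notin> mu")
    case True
    then have "A (r, c) = chart_row mu A r c" by (simp add: chart_row_def)
    also have "\<dots> = 0" using row[of r] True \<open>mu = lam\<close> by (simp add: cspace_def)
    finally show ?thesis .
  next
    case False
    then show ?thesis using A by (auto simp: cspace_def chart_coords_def)
  qed
  ultimately show ?thesis by (auto simp: fun_eq_iff)
qed

text \<open>
  Scaling the columns outside \<open>mu\<close> fixes the identity block of the matrix, so no renormalisation of
  the rows is needed; this is what makes the charts of torus-stable sets into cones.
\<close>
lemma chart_point_scaling:
  "chart_point mu (\<lambda>p. t * A p) = column_scaling (\<lambda>c. if c \<in> mu then 1 else t) ` chart_point mu A"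
  unfolding chart_point_eq module_hom.span_image[OF module_hom_column_scaling, symmetric] image_image
  by (intro arg_cong[where f = cvec.span] image_cong) (auto simp: chart_row_def column_scaling_def fun_eq_iff)

lemma finite_chart_coords: "mu \<subseteq> {1..int n} \<Longrightarrow> finite (chart_coords n mu)"
  by (auto simp: chart_coords_def intro: finite_subset)

definition chart_part :: "nat \<Rightarrow> int set \<Rightarrow> (int \<Rightarrow> complex) set set \<Rightarrow> (int \<times> int \<Rightarrow> complex) set" where
  "chart_part n mu P = {B \<in> cspace (chart_coords n mu). chart_point mu B \<in> P}"

lemma smooth_at_coord_plane_iff:
  assumes lam: "lam \<subseteq> {1..int n}" "card lam = k"
  shows "smooth_at k n P (coord_plane lam)
    \<longleftrightarrow> affine_smooth_at (chart_coords n lam) (chart_part n lam P) 0" (is "?L \<longleftrightarrow> ?R")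
proof
  assume ?L
  then obtain mu A where mu: "mu \<subseteq> {1..int n}" "card mu = k" "A \<in> cspace (chart_coords n mu)"
    "chart_point mu A = coord_plane lam" "affine_smooth_at (chart_coords n mu) (chart_part n mu P) A"
    by (auto simp: smooth_at_def chart_part_def)
  have "finite mu" "finite lam" using mu(1) lam(1) finite_subset by auto
  then have "mu = lam \<and> A = 0"
    using mu(2-4) lam(2) by (intro chart_point_eq_coord_plane) auto
  then show ?R using mu(5) by simp
next
  assume ?R
  moreover have "(0 :: int \<times> int \<Rightarrow> complex) \<in> cspace (chart_coords n lam)"
    using subspace_cspace by (rule cvec.subspace_0)
  ultimately show ?L using lam chart_point_0 unfolding smooth_at_def chart_part_def by blast
qed

lemma smooth_chart_part_subspace:
  assumes lam: "lam \<subseteq> {1..int n}" "card lam = k"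
    and torus: "\<And>V d. V \<in> P \<Longrightarrow> (\<And>c. d c \<noteq> 0) \<Longrightarrow> column_scaling d ` V \<in> P"
    and smooth: "smooth_at k n P (coord_plane lam)"
  shows "cvec.subspace (chart_part n lam P)"
proof (rule smooth_cone_subspace[OF finite_chart_coords[OF lam(1)]])
  show aff: "affine_smooth_at (chart_coords n lam) (chart_part n lam P) 0"
    using smooth smooth_at_coord_plane_iff[OF lam] by simp
  show "chart_part n lam P \<subseteq> cspace (chart_coords n lam)" by (auto simp: chart_part_def)
  fix A t assume A: "A \<in> chart_part n lam P"
  show "(\<lambda>p. t * A p) \<in> chart_part n lam P"
  \<comment> \<open>For \<open>t = 0\<close> the scaling is not invertible, but the origin is a point of a set smooth there.\<close>
  proof (cases "t = 0")
    case True
    then have "(\<lambda>p. t * A p) = 0" by (simp add: fun_eq_iff)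
    moreover have "0 \<in> chart_part n lam P" using aff by (simp add: affine_smooth_at_def)
    ultimately show ?thesis by (simp only:)
  next
    case False
    then have "chart_point lam (\<lambda>p. t * A p) \<in> P"
      unfolding chart_point_scaling using A by (intro torus) (auto simp: chart_part_def)
    then show ?thesis using A by (auto simp: chart_part_def cspace_def)
  qed
qed

section \<open>Deletion and contraction in charts\<close>

definition skip :: "int \<Rightarrow> int \<Rightarrow> int" where
  "skip i j = (if j < i then j else j + 1)"

definition unskip :: "int \<Rightarrow> int \<Rightarrow> int" where
  "unskip i j = (if j < i then j else j - 1)"

lemma skip_neq: "skip i j \<noteq> i" and unskip_skip: "unskip i (skip i j) = j"
  and skip_unskip: "j \<noteq> i \<Longrightarrow> skip i (unskip i j) = j"
  and skip_eq_iff: "skip i j = skip i j' \<longleftrightarrow> j = j'"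
  by (auto simp: skip_def unskip_def)

lemma drop_coord_skip: "drop_coord i v = (\<lambda>j. v (skip i j))"
  by (auto simp: drop_coord_def skip_def)

lemma skip_image_vimage: "skip i ` (skip i -` lam) = lam - {i}"
proof -
  have "j \<in> skip i ` (skip i -` lam)" if "j \<in> lam" "j \<noteq> i" for j
    using that skip_unskip[of j i] by (intro image_eqI[of _ _ "unskip i j"]) auto
  then show ?thesis using skip_neq by auto
qed

lemma card_skip_vimage: "card (skip i -` lam) = card (lam - {i})"
  unfolding skip_image_vimage[symmetric]
  by (rule card_image[symmetric]) (auto simp: inj_on_def skip_eq_iff)

lemma skip_vimage_interval:
  assumes "i \<in> {1..int n}"
  shows "skip i -` {1..int n} = {1..int (n - 1)}"
  using assms by (auto simp: skip_def of_nat_diff split: if_splits)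

lemma module_hom_drop_coord:
  "module_hom (\<lambda>(c::complex) (v :: int \<Rightarrow> complex) j. c * v j)
    (\<lambda>(c::complex) (v :: int \<Rightarrow> complex) j. c * v j) (drop_coord i)"
  by (rule cvec_module_hom) (auto simp: drop_coord_skip fun_eq_iff)

text \<open>
  Away from the index \<open>i\<close>, dropping a coordinate turns chart rows into chart rows. If \<open>i\<close> is in \<open>lam\<close>, the
  hypothesis makes the row of \<open>i\<close> equal to \<open>unit_vec i\<close>, which becomes \<open>0\<close> and adds nothing to the span.
\<close>
lemma drop_plane_chart_point:
  assumes "i \<in> lam \<Longrightarrow> \<forall>c. A (i, c) = 0"
  shows "drop_plane i (chart_point lam A)
    = chart_point (skip i -` lam) (\<lambda>(r, c). A (skip i r, skip i c))" (is "_ = chart_point ?lam ?A")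
proof -
  have row: "drop_coord i (chart_row lam A (skip i r)) = chart_row ?lam ?A r" for r
    by (auto simp: drop_coord_skip chart_row_def fun_eq_iff skip_eq_iff)
  have rows: "drop_coord i ` chart_row lam A ` (lam - {i}) = chart_row ?lam ?A ` ?lam"
    unfolding skip_image_vimage[symmetric] image_image by (simp add: row)
  have "cvec.span (drop_coord i ` chart_row lam A ` lam) = cvec.span (chart_row ?lam ?A ` ?lam)"
  proof (cases "i \<in> lam")
    case True
    have "drop_coord i (chart_row lam A i) = 0"
      using assms[OF True] by (auto simp: drop_coord_skip chart_row_def fun_eq_iff skip_neq)
    moreover have "lam = insert i (lam - {i})" using True by blast
    ultimately have "drop_coord i ` chart_row lam A ` lam = insert 0 (chart_row ?lam ?A ` ?lam)"
      using rows by (metis image_insert)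
    then show ?thesis by (simp add: cvec.span_insert_0)
  next
    case False
    then show ?thesis using rows by simp
  qed
  then show ?thesis
    by (simp add: chart_point_eq drop_plane_def module_hom.span_image[OF module_hom_drop_coord])
qed

lemma drop_plane_coord_plane: "drop_plane i (coord_plane lam) = coord_plane (skip i -` lam)"
proof -
  have "(\<lambda>(r, c). 0 (skip i r, skip i c)) = (0 :: int \<times> int \<Rightarrow> complex)" by auto
  then show ?thesis using drop_plane_chart_point[of i lam 0] by (simp add: chart_point_0)
qed

text \<open>
  Deletion and contraction run in parallel; of the two loci, this is the one that contains the
  coordinate plane of \<open>lam\<close>.
\<close>
definition minor_locus :: "nat \<Rightarrow> nat \<Rightarrow> int set \<Rightarrow> int \<Rightarrow> (int \<Rightarrow> complex) set set" where
  "minor_locus k n lam i = (if i \<in> lam then contr_locus k n i else del_locus k n i)"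

text \<open>
  Vectors with the same image under \<open>drop_coord i\<close> differ by a multiple of \<open>unit_vec i\<close>. So a plane is
  determined by its image if it is known either to lie in the coordinate hyperplane or to contain
  \<open>unit_vec i\<close>.
\<close>
lemma drop_plane_subset:
  assumes W: "cvec.subspace W" and sub: "drop_plane i V \<subseteq> drop_plane i W"
    and "(\<forall>x\<in>V \<union> W. x i = 0) \<or> unit_vec i \<in> W"
  shows "V \<subseteq> W"
proof
  fix v assume v: "v \<in> V"
  then obtain w where w: "w \<in> W" "drop_coord i v = drop_coord i w"
    using sub by (auto simp: drop_plane_def)
  have off: "v j = w j" if "j \<noteq> i" for j
    using fun_cong[OF w(2), of "unskip i j"] skip_unskip[OF that] by (simp add: drop_coord_skip)
  then have eq: "v = w + (\<lambda>j. (v i - w i) * unit_vec i j)"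
    by (auto simp: fun_eq_iff unit_vec_def)
  from assms(3) show "v \<in> W"
  proof
    assume "\<forall>x\<in>V \<union> W. x i = 0"
    then have "v i = 0" "w i = 0" using v w(1) by auto
    then have "v = w" using off by (metis ext)
    then show ?thesis using w(1) by simp
  next
    assume "unit_vec i \<in> W"
    then show ?thesis
      using cvec.subspace_add[OF W w(1) cvec.subspace_scale[OF W], of "unit_vec i" "v i - w i"] eq by metis
  qed
qed

lemma drop_plane_eq_imp_eq:
  assumes "cvec.subspace V" "cvec.subspace W" "drop_plane i V = drop_plane i W"
    and "(V \<subseteq> {x. x i = 0} \<and> W \<subseteq> {x. x i = 0}) \<or> (unit_vec i \<in> V \<and> unit_vec i \<in> W)"
  shows "V = W"
  using assms drop_plane_subset[of W i V] drop_plane_subset[of V i W] by blast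

text \<open>
  The linear inclusion of the chart of the smaller Grassmannian in the chart of the larger one, as
  the matrices whose row or column with index \<open>i\<close> is zero.
\<close>
definition minor_embedding :: "int \<Rightarrow> (int \<times> int \<Rightarrow> complex) \<Rightarrow> int \<times> int \<Rightarrow> complex" where
  "minor_embedding i B = (\<lambda>(r, c). if r = i \<or> c = i then 0 else B (unskip i r, unskip i c))"

lemma module_hom_minor_embedding:
  "module_hom (\<lambda>(c::complex) (v :: int \<times> int \<Rightarrow> complex) j. c * v j)
    (\<lambda>(c::complex) (v :: int \<times> int \<Rightarrow> complex) j. c * v j) (minor_embedding i)"
  by (rule cvec_module_hom) (auto simp: minor_embedding_def fun_eq_iff)

lemma minor_embedding_in_cspace:
  assumes i: "i \<in> {1..int n}" and B: "B \<in> cspace (chart_coords (n - 1) (skip i -` lam))"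
  shows "minor_embedding i B \<in> cspace (chart_coords n lam)"
proof -
  have "minor_embedding i B (r, c) = 0" if "(r, c) \<notin> chart_coords n lam" for r c
  proof (cases "r = i \<or> c = i")
    case False
    have "(unskip i r, unskip i c) \<notin> chart_coords (n - 1) (skip i -` lam)"
      using that False skip_unskip[of r i] skip_unskip[of c i]
      unfolding chart_coords_def skip_vimage_interval[OF i, symmetric] by auto
    then show ?thesis using B False by (auto simp: minor_embedding_def cspace_def)
  qed (auto simp: minor_embedding_def)
  then show ?thesis by (auto simp: cspace_def)
qed

lemma drop_plane_minor_embedding:
  "drop_plane i (chart_point lam (minor_embedding i B)) = chart_point (skip i -` lam) B"
proof -
  have "(\<lambda>(r, c). minor_embedding i B (skip i r, skip i c)) = B"
    by (auto simp: minor_embedding_def skip_neq unskip_skip)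
  then show ?thesis
    using drop_plane_chart_point[of i lam "minor_embedding i B"] by (simp add: minor_embedding_def)
qed

lemma minor_locus_iff:
  "V \<in> minor_locus k n lam i \<longleftrightarrow>
    V \<in> grassmannian k n \<and> (if i \<in> lam then unit_vec i \<in> V else V \<subseteq> {x. x i = 0})"
  by (auto simp: minor_locus_def contr_locus_def del_locus_def)

lemma chart_point_minor_embedding:
  "if i \<in> lam then unit_vec i \<in> chart_point lam (minor_embedding i B)
   else chart_point lam (minor_embedding i B) \<subseteq> {x. x i = 0}"
proof (cases "i \<in> lam")
  case True
  then have "chart_row lam (minor_embedding i B) i = unit_vec i"
    by (auto simp: chart_row_def minor_embedding_def unit_vec_def)
  then have "unit_vec i \<in> chart_point lam (minor_embedding i B)"
    unfolding chart_point_eq using True by (metis cvec.span_base imageI)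
  then show ?thesis using True by simp
next
  case False
  have "chart_point lam (minor_embedding i B) \<subseteq> {x. x i = 0}"
    unfolding chart_point_eq using False
    by (intro cvec.span_minimal) (auto simp: chart_row_def minor_embedding_def cvec.subspace_def)
  then show ?thesis using False by simp
qed

text \<open>
  Planes of embedded chart points lie in the locus, and a plane in the locus is recovered from its
  image under \<open>drop_plane i\<close>. So membership in the image of \<open>P\<close> pulls back to membership in \<open>P\<close>, and
  the right-hand side is a linear preimage.
\<close>
lemma chart_part_minor:
  assumes i: "i \<in> {1..int n}" and P: "P \<subseteq> grassmannian k n"
  shows "chart_part (n - 1) (skip i -` lam) (drop_plane i ` (P \<inter> minor_locus k n lam i))
    = cspace (chart_coords (n - 1) (skip i -` lam)) \<inter> {B. minor_embedding i B \<in> chart_part n lam P}"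
proof -
  have "chart_point (skip i -` lam) B \<in> drop_plane i ` (P \<inter> minor_locus k n lam i)
      \<longleftrightarrow> chart_point lam (minor_embedding i B) \<in> P" (is "?l \<longleftrightarrow> ?V \<in> P")
    if B: "B \<in> cspace (chart_coords (n - 1) (skip i -` lam))" for B
  proof
    assume "?V \<in> P"
    then have "?V \<in> P \<inter> minor_locus k n lam i"
      using P chart_point_minor_embedding[of i lam B] by (auto simp: minor_locus_iff)
    then show ?l unfolding drop_plane_minor_embedding[symmetric] by (rule imageI)
  next
    assume ?l
    then obtain W where W: "W \<in> P" "W \<in> minor_locus k n lam i" "drop_plane i ?V = drop_plane i W"
      by (auto simp: drop_plane_minor_embedding)
    have "?V = W"
    proof (rule drop_plane_eq_imp_eq[OF _ _ W(3)])
      show "cvec.subspace ?V" by (simp add: chart_point_eq)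
      show "cvec.subspace W" using W(1) P by (auto simp: grassmannian_def)
      show "(?V \<subseteq> {x. x i = 0} \<and> W \<subseteq> {x. x i = 0}) \<or> (unit_vec i \<in> ?V \<and> unit_vec i \<in> W)"
        using W(2) chart_point_minor_embedding[of i lam B] by (auto simp: minor_locus_iff split: if_splits)
    qed
    then show "?V \<in> P" using W by simp
  qed
  then show ?thesis using minor_embedding_in_cspace[OF i] by (auto simp: chart_part_def)
qed

lemma smooth_at_minor:
  assumes lam: "lam \<subseteq> {1..int n}" and i: "i \<in> {1..int n}" and P: "P \<subseteq> grassmannian k n"
    and sub: "cvec.subspace (chart_part n lam P)"
  shows "smooth_at (card (lam - {i})) (n - 1) (drop_plane i ` (P \<inter> minor_locus k n lam i))
    (drop_plane i (coord_plane lam))"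
proof -
  let ?lam = "skip i -` lam"
  let ?X = "chart_part (n - 1) ?lam (drop_plane i ` (P \<inter> minor_locus k n lam i))"
  have lam': "?lam \<subseteq> {1..int (n - 1)}"
    using vimage_mono[OF lam, of "skip i"] skip_vimage_interval[OF i] by simp
  have "cvec.subspace ?X"
    unfolding chart_part_minor[OF i P]
    by (intro cvec.subspace_inter subspace_cspace module_hom.subspace_linear_preimage[OF module_hom_minor_embedding] sub)
  then have "affine_smooth_at (chart_coords (n - 1) ?lam) ?X 0"
    by (intro affine_smooth_at_subspace finite_chart_coords[OF lam']) (auto simp: chart_part_def)
  then show ?thesis
    using smooth_at_coord_plane_iff[OF lam' card_skip_vimage] by (simp add: drop_plane_coord_plane)
qed

theorem proposition10:
  fixes k n :: nat and f :: "int \<Rightarrow> int" and lam :: "int set"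
  assumes "bounded_affine_perm k n f"
    and "lam \<subseteq> {1..int n}" and "card lam = k"
    and "coord_plane lam \<in> positroid_variety k n f"
  shows "(smooth_at k n (positroid_variety k n f) (coord_plane lam) \<longrightarrow>
            (\<forall>i \<in> {1..int n} - lam.
               smooth_at k (n - 1) (deletion k n f i) (drop_plane i (coord_plane lam))) \<and>
            (\<forall>i \<in> lam.
               smooth_at (k - 1) (n - 1) (contraction k n f i) (drop_plane i (coord_plane lam))))
       \<and> ((\<exists>i \<in> {1..int n} - lam.
               singular_at k (n - 1) (deletion k n f i) (drop_plane i (coord_plane lam))) \<or>
          (\<exists>i \<in> lam.
               singular_at (k - 1) (n - 1) (contraction k n f i) (drop_plane i (coord_plane lam)))
            \<longrightarrow> singular_at k n (positroid_variety k n f) (coord_plane lam))"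
proof -
  let ?P = "positroid_variety k n f"
  have minor: "smooth_at (card (lam - {i})) (n - 1) (drop_plane i ` (?P \<inter> minor_locus k n lam i))
      (drop_plane i (coord_plane lam))"
    if "smooth_at k n ?P (coord_plane lam)" "i \<in> {1..int n}" for i
    using assms(2) that(2) positroid_variety_subset_grassmannian
  proof (rule smooth_at_minor)
    show "cvec.subspace (chart_part n lam ?P)"
      using assms(2,3) positroid_variety_scaling that(1) by (rule smooth_chart_part_subspace)
  qed
  have del: "smooth_at k (n - 1) (deletion k n f i) (drop_plane i (coord_plane lam))"
    if "smooth_at k n ?P (coord_plane lam)" "i \<in> {1..int n} - lam" for i
    using minor[OF that(1), of i] that(2) assms(3) by (simp add: deletion_def minor_locus_def)
  have contr: "smooth_at (k - 1) (n - 1) (contraction k n f i) (drop_plane i (coord_plane lam))"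
    if "smooth_at k n ?P (coord_plane lam)" "i \<in> lam" for i
  proof -
    have "i \<in> {1..int n}" using that(2) assms(2) by blast
    then show ?thesis
      using minor[OF that(1), of i] that(2) assms(3) by (simp add: contraction_def minor_locus_def)
  qed
  show ?thesis using del contr assms(4) unfolding singular_at_def by blast
qed

end
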